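(* Let $A\in\mathbb{R}^{n\times n}$ be symmetric positive definite with all eigenvalues in $[a,b]$, where $0<a<b$. Let $0<\varepsilon\le 1$, $p\ge1$, $q=p/2$, $\kappa=\sqrt{b/a}$. Let $\psi_N$ be the degree-$N$ Chebyshev approximation of $x^{p/2}$ on $[a,b]$, let $\phi_N(A)=[\psi_N(A)]^2$, and let $$Y_{M,N}=\left(\frac1M\sum_{j=1}^M w_j^T\phi_N(A)w_j\right)^{1/p},$$ with $w_1,\dots,w_M$ independent standard Gaussian random vectors in $\mathbb{R}^n$. Suppose that $N$ satisfies $$N\ \ge\ \frac{\log\left(\frac{4}{\varepsilon}(\kappa^2+1)^q(\kappa-1)\left(\kappa^p+\sqrt{\frac{\varepsilon}{2}+\kappa^{2p}}\right)\right)}{\log\left(\frac{\kappa+1}{\kappa-1}\right)} .$$ Then: 1. For every $M\ge1$, $$\big|\mathbb{E}(Y_{M,N})-\|A\|_{S_p}\big|\ \le\ \Big(1+\frac{\varepsilon}{2}\Big)\|A\|_{S_p}\Big(\frac{2}{M}\Big)^{1/2}+\frac{\varepsilon}{2}\|A\|_{S_p}.$$ 2. For every $\delta\in(0,1)$, if $M\ge 72\,\varepsilon^{-2}\ln\left(\frac2\delta\right)$, then $Y_{M,N}$ is an $(\varepsilon,\delta)$ estimator for $\|A\|_{S_p}$, that is, $\mathbb{P}\big(|Y_{M,N}-\|A\|_{S_p}|\le\varepsilon\|A\|_{S_p}\big)\ge 1-\delta$.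
   Context: For a symmetric positive semidefinite matrix $A\in\mathbb{R}^{n\times n}$ with eigenvalues $\lambda_1,\dots,\lambda_n\ge0$ and $p\ge1$, the Schatten $p$-norm is $\|A\|_{S_p}=\big(\sum_{j=1}^n\lambda_j^p\big)^{1/p}=(\operatorname{tr}(A^p))^{1/p}$. Chebyshev approximation: $T_j(x)=\cos(j\arccos x)$, $x\in[-1,1]$, is the $j$th Chebyshev polynomial of the first kind. The degree-$N$ Chebyshev approximation of $g(x)=x^{p/2}$ on $[a,b]$ is the truncated Chebyshev series $$\psi_N(x)=c_0+\sum_{j=1}^N c_j\,T_j\Big(\frac{2}{b-a}x-\frac{b+a}{b-a}\Big),$$ where $c_j=\frac2\pi\int_0^\pi g\big(\tfrac{b-a}{2}\cos\theta+\tfrac{b+a}{2}\big)\cos(j\theta)\,d\theta$ for $j\ge1$ and $c_0=\frac1\pi\int_0^\pi g\big(\tfrac{b-a}{2}\cos\theta+\tfrac{b+a}{2}\big)\,d\theta$. The polynomials $\psi_N$ and $\phi_N=\psi_N^2$ are applied to matrices as matrix polynomials. The samples $w_j$ are independent random vectors on a probability space $(\Omega,\mathcal{F},\mathbb{P})$ whose entries are independent standard normal random variables. *)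

theory Defs
  imports "HOL-Probability.Probability" "HOL-Computational_Algebra.Computational_Algebra"
begin

section \<open>Eigenvalues and the Schatten norm\<close>

text \<open>On \<open>real^'n^'n\<close> the type class operations \<open>*\<close> and \<open>^\<close> act entrywise;
  the matrix product is \<open>**\<close>.\<close>

definition char_poly :: "real^'n^'n \<Rightarrow> real poly" where
  "char_poly A = det (\<chi> i j. (if i = j then [:0, 1:] else 0) - [:A $ i $ j:])"

text \<open>Only the real eigenvalues are collected, with algebraic multiplicity. For the symmetric
  matrices considered here these are all the eigenvalues \<open>\<lambda>\<^sub>1, \<dots>, \<lambda>\<^sub>n\<close>.\<close>

definition eigenvalues :: "real^'n^'n \<Rightarrow> real multiset" where
  "eigenvalues A = proots (char_poly A)"

definition schatten_norm :: "real \<Rightarrow> real^'n^'n \<Rightarrow> real" where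
  "schatten_norm p A = (\<Sum>\<mu>\<in>#eigenvalues A. \<mu> powr p) powr (1 / p)"

definition sym_pos_def :: "real^'n^'n \<Rightarrow> bool" where
  "sym_pos_def A \<longleftrightarrow> transpose A = A \<and> (\<forall>x. x \<noteq> 0 \<longrightarrow> x \<bullet> (A *v x) > 0)"

lemma poly_det: "poly (det B) x = det (\<chi> i j. poly (B $ i $ j) x)"
  for B :: "real poly^'n^'n"
  unfolding det_def by (simp add: poly_sum poly_prod)

lemma poly_char_poly: "poly (char_poly A) x = det (mat x - A)"
  unfolding char_poly_def poly_det
  by (rule arg_cong[where f = det]) (simp add: vec_eq_iff mat_def)

lemma char_poly_eq_0_iff: "poly (char_poly A) x = 0 \<longleftrightarrow> (\<exists>v. v \<noteq> 0 \<and> A *v v = x *\<^sub>R v)"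
proof -
  have mat_vec: "mat x *v v = x *\<^sub>R v" for v :: "real^'n"
    by (simp add: vec_eq_iff matrix_vector_mult_def mat_def if_distrib [of "\<lambda>c. c * _"]
        cong: if_cong)
  have "poly (char_poly A) x = 0 \<longleftrightarrow> \<not> invertible (mat x - A)"
    by (simp add: poly_char_poly invertible_det_nz)
  also have "\<dots> \<longleftrightarrow> (\<exists>v. (mat x - A) *v v = 0 \<and> v \<noteq> 0)"
    unfolding invertible_left_inverse matrix_left_invertible_ker by auto
  also have "\<dots> \<longleftrightarrow> (\<exists>v. v \<noteq> 0 \<and> A *v v = x *\<^sub>R v)"
    by (metis matrix_vector_mult_diff_rdistrib mat_vec right_minus_eq)
  finally show ?thesis .
qed

lemma char_poly_nonzero: "char_poly A \<noteq> 0"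
proof
  assume "char_poly A = 0"
  then have eig: "\<exists>v. v \<noteq> 0 \<and> A *v v = x *\<^sub>R v" for x
    using char_poly_eq_0_iff[of A x] by simp
  obtain K where K: "\<And>v. norm (A *v v) \<le> norm v * K"
    using bounded_linear.bounded[OF matrix_vector_mul_bounded_linear[of A]] by blast
  obtain v where v: "v \<noteq> 0" "A *v v = (\<bar>K\<bar> + 1) *\<^sub>R v"
    using eig by blast
  from K[of v] v show False
    by (simp add: mult.commute)
qed

lemma in_eigenvalues_iff: "x \<in># eigenvalues A \<longleftrightarrow> (\<exists>v. v \<noteq> 0 \<and> A *v v = x *\<^sub>R v)"
  by (simp add: eigenvalues_def char_poly_nonzero char_poly_eq_0_iff)


section \<open>Chebyshev approximation\<close>

definition chebyshev_T :: "nat \<Rightarrow> real poly" where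
  "chebyshev_T j = (THE P. \<forall>x\<in>{-1..1}. poly P x = cos (real j * arccos x))"

lemma chebyshev_T_exists: "\<exists>P. \<forall>x\<in>{-1..1}. poly P x = cos (real j * arccos x)"
proof (induction j rule: less_induct)
  case (less j)
  consider "j = 0" | "j = 1" | k where "j = Suc (Suc k)"
    by (metis One_nat_def not0_implies_Suc)
  then show ?case
  proof cases
    case 1
    then show ?thesis by (intro exI[of _ 1]) simp
  next
    case 2
    then show ?thesis by (intro exI[of _ "[:0, 1:]"]) simp
  next
    case 3
    obtain P Q where P: "\<And>x. x \<in> {-1..1} \<Longrightarrow> poly P x = cos (real k * arccos x)"
      and Q: "\<And>x. x \<in> {-1..1} \<Longrightarrow> poly Q x = cos (real (Suc k) * arccos x)"
      using less[of k] less[of "Suc k"] unfolding 3 by (metis lessI less_SucI)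
    have "poly ([:0, 2:] * Q - P) x = cos (real j * arccos x)" if x: "x \<in> {-1..1}" for x
    proof -
      define t where "t = arccos x"
      have ct: "cos t = x"
        using x by (simp add: t_def)
      have "cos (real j * t) + cos (real k * t) = 2 * cos t * cos (real (Suc k) * t)"
        using cos_times_cos[of "real (Suc k) * t" t] by (simp add: 3 algebra_simps)
      then show ?thesis
        using P[OF x] Q[OF x] ct by (simp add: t_def algebra_simps)
    qed
    then show ?thesis by blast
  qed
qed

lemma poly_chebyshev_T:
  assumes "x \<in> {-1..1}"
  shows "poly (chebyshev_T j) x = cos (real j * arccos x)"
proof -
  have "\<exists>!P. \<forall>x\<in>{-1..1}. poly P x = cos (real j * arccos x)"
  proof (rule ex_ex1I[OF chebyshev_T_exists])
    fix P Q :: "real poly"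
    assume PQ: "\<forall>x\<in>{-1..1}. poly P x = cos (real j * arccos x)"
      "\<forall>x\<in>{-1..1}. poly Q x = cos (real j * arccos x)"
    show "P = Q"
    proof (rule ccontr)
      assume "P \<noteq> Q"
      then have "finite {x. poly (P - Q) x = 0}"
        by (intro poly_roots_finite) simp
      moreover have "{-1..1} \<subseteq> {x. poly (P - Q) x = 0}"
        using PQ by auto
      moreover have "infinite {-1..1::real}"
        by (rule infinite_Icc) simp
      ultimately show False
        using finite_subset by blast
    qed
  qed
  from theI'[OF this] assms show ?thesis
    unfolding chebyshev_T_def by blast
qed

definition chebyshev_coeff :: "(real \<Rightarrow> real) \<Rightarrow> real \<Rightarrow> real \<Rightarrow> nat \<Rightarrow> real" where
  "chebyshev_coeff g a b j =
    (if j = 0 then 1 / pi else 2 / pi) *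
      integral {0..pi} (\<lambda>\<theta>. g ((b - a) / 2 * cos \<theta> + (b + a) / 2) * cos (real j * \<theta>))"

definition chebyshev_approx :: "(real \<Rightarrow> real) \<Rightarrow> real \<Rightarrow> real \<Rightarrow> nat \<Rightarrow> real poly" where
  "chebyshev_approx g a b N =
    [:chebyshev_coeff g a b 0:] +
    (\<Sum>j=1..N. smult (chebyshev_coeff g a b j)
      (pcompose (chebyshev_T j) [:- ((b + a) / (b - a)), 2 / (b - a):]))"


section \<open>Matrix polynomials\<close>

definition matrix_power :: "real^'n^'n \<Rightarrow> nat \<Rightarrow> real^'n^'n" where
  "matrix_power A k = (((**) A) ^^ k) (mat 1)"

definition matrix_poly :: "real poly \<Rightarrow> real^'n^'n \<Rightarrow> real^'n^'n" where
  "matrix_poly f A = (\<Sum>i\<le>degree f. coeff f i *\<^sub>R matrix_power A i)"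


section \<open>Gaussian samples and the estimator\<close>

definition std_gaussian_vector :: "'a measure \<Rightarrow> ('a \<Rightarrow> real^'n) \<Rightarrow> bool" where
  "std_gaussian_vector P X \<longleftrightarrow>
    prob_space.indep_vars P (\<lambda>_. borel) (\<lambda>i \<omega>. X \<omega> $ i) UNIV \<and>
    (\<forall>i. distributed P lborel (\<lambda>\<omega>. X \<omega> $ i) std_normal_density)"

definition indep_std_gaussian_vectors :: "'a measure \<Rightarrow> nat \<Rightarrow> (nat \<Rightarrow> 'a \<Rightarrow> real^'n) \<Rightarrow> bool" where
  "indep_std_gaussian_vectors P M w \<longleftrightarrow>
    prob_space.indep_vars P (\<lambda>_. borel) w {1..M} \<and>
    (\<forall>j\<in>{1..M}. std_gaussian_vector P (w j))"

definition psi :: "real \<Rightarrow> real \<Rightarrow> real \<Rightarrow> nat \<Rightarrow> real poly" where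
  "psi p a b N = chebyshev_approx (\<lambda>x. x powr (p / 2)) a b N"

definition phi_matrix :: "real \<Rightarrow> real \<Rightarrow> real \<Rightarrow> nat \<Rightarrow> real^'n^'n \<Rightarrow> real^'n^'n" where
  "phi_matrix p a b N A = matrix_poly (psi p a b N) A ** matrix_poly (psi p a b N) A"

definition Y_est ::
  "real \<Rightarrow> real \<Rightarrow> real \<Rightarrow> real^'n^'n \<Rightarrow> (nat \<Rightarrow> 'a \<Rightarrow> real^'n) \<Rightarrow> nat \<Rightarrow> nat \<Rightarrow> 'a \<Rightarrow> real" where
  "Y_est p a b A w M N \<omega> =
    (1 / real M * (\<Sum>j=1..M. w j \<omega> \<bullet> (phi_matrix p a b N A *v w j \<omega>))) powr (1 / p)"

definition eps_delta_estimator :: "'a measure \<Rightarrow> real \<Rightarrow> real \<Rightarrow> ('a \<Rightarrow> real) \<Rightarrow> real \<Rightarrow> bool" where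
  "eps_delta_estimator P \<epsilon> \<delta> Y \<tau> \<longleftrightarrow>
    measure P {\<omega> \<in> space P. \<bar>Y \<omega> - \<tau>\<bar> \<le> \<epsilon> * \<tau>} \<ge> 1 - \<delta>"

end

theory Submission
  imports Defs "HOL-Complex_Analysis.Complex_Analysis"
begin

text \<open>
  Diagonalise \<open>A = Q D Q\<^sup>T\<close>. The Gaussian law is invariant under \<open>Q\<^sup>T\<close>, so the estimator is
  \<open>X powr (1 / p)\<close> with \<open>X\<close> a mean of \<open>M\<close> independent sums \<open>\<Sum>\<^sub>i e\<^sub>i g\<^sub>i\<^sup>2\<close>, where
  \<open>e\<^sub>i = (\<psi>\<^sub>N(\<lambda>\<^sub>i))\<^sup>2\<close>. Put \<open>T = \<Sum>\<^sub>i e\<^sub>i\<close> and \<open>S = \<Sum>\<^sub>i \<lambda>\<^sub>i\<^sup>p\<close>.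

  Bias: with \<open>x = (b - a) / 2 \<cdot> cos t + (b + a) / 2\<close>, the function \<open>x powr (p / 2)\<close> is the restriction
  to the unit circle of a holomorphic function bounded by \<open>(a + b) powr (p / 2)\<close> on the annulus of
  radii \<open>1 / \<rho>\<close> and \<open>\<rho> = (\<kappa> + 1) / (\<kappa> - 1)\<close>. Its Laurent partial sums are the Chebyshev partial
  sums, so the Chebyshev error decays like \<open>\<rho>\<close> to the power \<open>-N\<close>, and the condition on \<open>N\<close> gives
  \<open>\<bar>T / S - 1\<bar> \<le> \<epsilon> / 2\<close>.

  Fluctuation: \<open>X / T\<close> has mean 1 and variance at most \<open>2 / M\<close>, and a Chernoff bound gives
  \<open>P(\<bar>X / T - 1\<bar> > \<eta>) \<le> 2 exp (- M \<eta>\<^sup>2 / 8)\<close>, used with \<open>\<eta> = \<epsilon> / 3\<close>. Both relative errors pass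
  to the \<open>p\<close>-th roots because \<open>\<bar>u powr r - 1\<bar> \<le> \<bar>u - 1\<bar>\<close> for \<open>0 \<le> r \<le> 1\<close>.
\<close>

section \<open>Spectral theorem for real symmetric matrices\<close>

definition diag_matrix :: "('n \<Rightarrow> real) \<Rightarrow> real^'n^'n" where
  "diag_matrix d = (\<chi> i j. if i = j then d i else 0)"

text \<open>A maximiser of the Rayleigh quotient on the unit sphere of \<open>V\<close> is an eigenvector.\<close>

lemma symmetric_matrix_eigenvector_in_subspace:
  fixes A :: "real^'n^'n"
  assumes sym: "transpose A = A" and V: "subspace V" and inv: "\<And>x. x \<in> V \<Longrightarrow> A *v x \<in> V"
    and ne: "\<exists>x\<in>V. x \<noteq> 0"
  shows "\<exists>v\<in>V. norm v = 1 \<and> (\<exists>l. A *v v = l *\<^sub>R v)"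
proof -
  have adj: "x \<bullet> (A *v y) = (A *v x) \<bullet> y" for x y
    by (metis dot_lmul_matrix sym transpose_matrix_vector)
  let ?S = "V \<inter> sphere 0 1"
  obtain x where x: "x \<in> V" "x \<noteq> 0" using ne by blast
  have "x /\<^sub>R norm x \<in> ?S"
    using x V by (simp add: subspace_scale)
  then have "?S \<noteq> {}" by blast
  moreover have "compact ?S"
    using V by (intro closed_Int_compact closed_subspace) auto
  moreover have "continuous_on ?S (\<lambda>x. x \<bullet> (A *v x))"
    by (intro continuous_intros linear_continuous_on matrix_vector_mul_bounded_linear)
  ultimately obtain v where v: "v \<in> ?S" and max: "\<And>y. y \<in> ?S \<Longrightarrow> y \<bullet> (A *v y) \<le> v \<bullet> (A *v v)"
    using continuous_attains_sup[of ?S "\<lambda>x. x \<bullet> (A *v x)"] by blast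
  define l where "l = v \<bullet> (A *v v)"
  define u where "u = A *v v - l *\<^sub>R v"
  have vV: "v \<in> V" and v1: "norm v = 1" using v by auto
  have vv: "v \<bullet> v = 1" using v1 by (simp add: dot_square_norm)
  have uV: "u \<in> V"
    unfolding u_def using vV inv V by (intro subspace_diff subspace_scale) auto
  \<comment> \<open>The bound on the unit sphere extends to all of \<open>V\<close> because both
    sides are quadratic in \<open>y\<close>.\<close>
  have quad: "y \<bullet> (A *v y) \<le> l * (y \<bullet> y)" if "y \<in> V" for y
  proof (cases "y = 0")
    case False
    have "y /\<^sub>R norm y \<in> ?S" using that False V by (simp add: subspace_scale)
    from max[OF this] have "(y \<bullet> (A *v y)) / (norm y)\<^sup>2 \<le> l"
      by (simp add: l_def matrix_vector_mult_scaleR power2_eq_square divide_simps)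
    then show ?thesis
      using False by (simp add: divide_le_eq dot_square_norm)
  qed simp
  have "u = 0"
  proof (rule ccontr)
    assume "u \<noteq> 0"
    then have uu: "u \<bullet> u > 0" by simp
    define c where "c = l * (u \<bullet> u) - u \<bullet> (A *v u)"
    \<comment> \<open>Compare \<open>v\<close> with \<open>v + t *\<^sub>R u\<close>: maximality of
      \<open>v\<close> forces the first-order gain \<open>2 * t * (u \<bullet> u)\<close> below the
      second-order term \<open>t\<^sup>2 * c\<close>.\<close>
    have key: "2 * t * (u \<bullet> u) \<le> t\<^sup>2 * c" for t
    proof -
      have "v + t *\<^sub>R u \<in> V" using vV uV V by (intro subspace_add subspace_scale)
      from quad[OF this] have "l + 2 * t * (u \<bullet> (A *v v)) + t\<^sup>2 * (u \<bullet> (A *v u))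
        \<le> l * (1 + 2 * t * (u \<bullet> v) + t\<^sup>2 * (u \<bullet> u))"
        using adj[of v u] vv by (simp add: matrix_vector_right_distrib matrix_vector_mult_scaleR
           inner_add inner_commute l_def power2_eq_square algebra_simps)
      moreover have "u \<bullet> (A *v v) - l * (u \<bullet> v) = u \<bullet> u"
        by (metis inner_diff_right inner_scaleR_right u_def)
      ultimately show ?thesis
        unfolding c_def by (simp add: algebra_simps)
    qed
    \<comment> \<open>This \<open>t\<close> keeps \<open>t * c\<close> below
      \<open>u \<bullet> u\<close>, so \<open>key\<close> would give
      \<open>2 * (u \<bullet> u) \<le> u \<bullet> u\<close>.\<close>
    define t where "t = (u \<bullet> u) / (\<bar>c\<bar> + 1)"
    have t: "t > 0" using uu by (simp add: t_def)
    have "2 * (u \<bullet> u) \<le> t * c"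
      using key[of t] t by (simp add: power2_eq_square mult.assoc mult_ac)
    also have "\<dots> \<le> t * (\<bar>c\<bar> + 1)"
      using t by (intro mult_left_mono) auto
    also have "\<dots> = u \<bullet> u" by (simp add: t_def)
    finally show False using uu by simp
  qed
  then show ?thesis
    using vV v1 by (auto simp: u_def)
qed

text \<open>An orthonormal system of eigenvectors of maximal size spans the space. Otherwise its
  orthogonal complement is nonzero and, by symmetry of \<open>A\<close>, invariant, so it contains a
  further unit eigenvector.\<close>

lemma symmetric_matrix_orthonormal_eigenbasis:
  fixes A :: "real^'n^'n"
  assumes sym: "transpose A = A"
  shows "\<exists>B. pairwise orthogonal B \<and> (\<forall>b\<in>B. norm b = 1 \<and> (\<exists>l. A *v b = l *\<^sub>R b))
    \<and> finite B \<and> card B = CARD('n)"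
proof -
  have adj: "x \<bullet> (A *v y) = (A *v x) \<bullet> y" for x y
    by (metis dot_lmul_matrix sym transpose_matrix_vector)
  define E where "E = (\<lambda>B. pairwise orthogonal B \<and> (\<forall>b\<in>B. norm b = 1 \<and> (\<exists>l. A *v b = l *\<^sub>R b)))"
  have indep: "independent B" if "E B" for B
    by (rule pairwise_orthogonal_independent) (use that in \<open>auto simp: E_def\<close>)
  have bound: "finite B" "card B \<le> CARD('n)" if "E B" for B
    using independent_bound[OF indep[OF that]] by auto
  \<comment> \<open>Orthonormal sets are independent, so their sizes are bounded by
    \<open>CARD('n)\<close>; the empty set shows that the maximum is over a nonempty set.\<close>
  define k where "k = Max (card ` Collect E)"
  have fin: "finite (card ` Collect E)"
    by (rule finite_subset[of _ "{..CARD('n)}"]) (auto dest: bound(2))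
  have "E {}" by (simp add: E_def)
  then have "k \<in> card ` Collect E"
    unfolding k_def using fin by (intro Max_in) auto
  then obtain B where B: "E B" and k: "card B = k" by auto
  have "\<not> dim B < DIM(real^'n)"
  proof
    assume "dim B < DIM(real^'n)"
    then obtain x where x: "x \<noteq> 0" "\<And>y. y \<in> span B \<Longrightarrow> orthogonal x y"
      using orthogonal_to_subspace_exists by blast
    define V where "V = {x. \<forall>b\<in>B. b \<bullet> x = 0}"
    have "\<exists>v\<in>V. norm v = 1 \<and> (\<exists>l. A *v v = l *\<^sub>R v)"
    proof (rule symmetric_matrix_eigenvector_in_subspace[OF sym])
      show "subspace V" unfolding V_def by (auto simp: subspace_def inner_add_right)
      show "\<exists>x\<in>V. x \<noteq> 0"
        using x(1) x(2)[OF span_base]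
        by (intro bexI[of _ x]) (auto simp: V_def orthogonal_def inner_commute)
      fix y assume y: "y \<in> V"
      show "A *v y \<in> V" unfolding V_def
      proof safe
        fix b assume b: "b \<in> B"
        then obtain l where "A *v b = l *\<^sub>R b" using B by (auto simp: E_def)
        then show "b \<bullet> (A *v y) = 0" using y b by (simp add: adj V_def)
      qed
    qed
    then obtain v l where v: "v \<in> V" "norm v = 1" "A *v v = l *\<^sub>R v" by blast
    \<comment> \<open>A vector in both \<open>V\<close> and \<open>B\<close> would be orthogonal to
      itself, contradicting norm 1.\<close>
    have "v \<notin> B" using v by (auto simp: V_def)
    moreover have "E (insert v B)"
      using B v by (auto simp: E_def V_def pairwise_insert orthogonal_def inner_commute)
    ultimately have "Suc k \<in> card ` Collect E"
      using k bound(1)[OF B] by (intro image_eqI[of _ _ "insert v B"]) auto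
    then have "Suc k \<le> k" unfolding k_def using fin by (intro Max_ge) auto
    then show False by simp
  qed
  then have "card B = CARD('n)"
    using dim_eq_card_independent[OF indep[OF B]] bound(2)[OF B] by simp
  then show ?thesis
    using B bound(1)[OF B] by (auto simp: E_def)
qed

section \<open>Orthogonal diagonalisation and functions of the diagonalised matrix\<close>

lemma orthogonal_diag_conj_nth:
  fixes Q :: "real^'n^'n"
  shows "(Q ** diag_matrix d ** transpose Q) $ i $ j = (\<Sum>k\<in>UNIV. d k * Q $ i $ k * Q $ j $ k)"
  by (simp add: matrix_matrix_mult_def diag_matrix_def transpose_def if_distrib mult_ac cong: if_cong)

theorem symmetric_matrix_diagonalization:
  fixes A :: "real^'n^'n"
  assumes sym: "transpose A = A"
  obtains Q d where "orthogonal_matrix Q" "A = Q ** diag_matrix d ** transpose Q"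
proof -
  obtain B where B: "pairwise orthogonal B" "\<And>b. b \<in> B \<Longrightarrow> norm b = 1"
    "\<And>b. b \<in> B \<Longrightarrow> \<exists>l. A *v b = l *\<^sub>R b" "finite B" "card B = CARD('n)"
    using symmetric_matrix_orthonormal_eigenbasis[OF sym] by blast
  obtain e where e: "bij_betw e (UNIV :: 'n set) B"
    using finite_same_card_bij[of "UNIV :: 'n set" B] B by auto
  have eB: "e i \<in> B" for i using e by (auto simp: bij_betw_def)
  obtain d where d: "\<And>i. A *v e i = d i *\<^sub>R e i"
    using B(3)[OF eB] by metis
  define Q where "Q = (\<chi> i j. e j $ i)"
  have ee: "e i \<bullet> e j = (if i = j then 1 else 0)" for i j
  proof (cases "i = j")
    case True
    then show ?thesis using B(2)[OF eB] by (simp add: dot_square_norm)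
  next
    case False
    then have "e i \<noteq> e j" using e by (auto simp: bij_betw_def inj_on_def)
    then show ?thesis using B(1) eB False by (auto simp: pairwise_def orthogonal_def)
  qed
  have "transpose Q ** Q = mat 1"
    using ee by (simp add: vec_eq_iff matrix_matrix_mult_def transpose_def Q_def mat_def inner_vec_def)
  then have Q: "orthogonal_matrix Q" by (simp add: orthogonal_matrix)
  have "A ** Q = Q ** diag_matrix d"
  proof -
    have "(A ** Q) $ i $ j = (A *v e j) $ i" for i j
      by (simp add: matrix_matrix_mult_def matrix_vector_mult_def Q_def)
    moreover have "(Q ** diag_matrix d) $ i $ j = d j * e j $ i" for i j
      by (simp add: matrix_matrix_mult_def diag_matrix_def Q_def if_distrib mult_ac cong: if_cong)
    ultimately show ?thesis
      by (simp add: vec_eq_iff d)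
  qed
  then have "A ** Q ** transpose Q = Q ** diag_matrix d ** transpose Q" by simp
  moreover have "A ** Q ** transpose Q = A"
    using Q by (simp add: orthogonal_matrix_def matrix_mul_assoc[symmetric])
  ultimately show ?thesis using that Q by metis
qed

text \<open>Conjugation by \<open>Q\<close> leaves the characteristic polynomial unchanged, and for
  the diagonal matrix it splits into the factors \<open>[:- d i, 1:]\<close>, so its roots are the
  \<open>d i\<close> with multiplicity.\<close>

lemma eigenvalues_orthogonal_diag_conj:
  fixes Q :: "real^'n^'n"
  assumes Q: "orthogonal_matrix Q"
  shows "eigenvalues (Q ** diag_matrix d ** transpose Q) = image_mset d (mset_set UNIV)"
proof -
  let ?A = "Q ** diag_matrix d ** transpose Q"
  have QQ: "Q ** transpose Q = mat 1" using Q by (simp add: orthogonal_matrix_def)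
  have QQ': "(\<Sum>k\<in>UNIV. Q $ i $ k * Q $ j $ k) = (if i = j then 1 else 0)" for i j
    using arg_cong[OF QQ, of "\<lambda>M. M $ i $ j"] by (simp add: matrix_matrix_mult_def transpose_def mat_def)
  have detQ: "det Q * det Q = 1"
    using arg_cong[OF QQ, of det] by (simp add: det_mul det_I)
  have "poly (char_poly ?A) x = (\<Prod>i\<in>UNIV. x - d i)" for x
  proof -
    have "mat x - ?A = Q ** diag_matrix (\<lambda>i. x - d i) ** transpose Q"
      unfolding vec_eq_iff
      by (simp add: orthogonal_diag_conj_nth algebra_simps sum_subtractf mat_def QQ'
           flip: sum_distrib_left)
    then have "poly (char_poly ?A) x = det (Q ** diag_matrix (\<lambda>i. x - d i) ** transpose Q)"
      by (simp add: poly_char_poly)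
    also have "\<dots> = (det Q * det Q) * det (diag_matrix (\<lambda>i. x - d i) :: real^'n^'n)"
      by (simp add: det_mul)
    also have "det (diag_matrix (\<lambda>i. x - d i) :: real^'n^'n) = (\<Prod>i\<in>UNIV. x - d i)"
      by (subst det_diagonal) (auto simp: diag_matrix_def)
    finally show ?thesis by (simp add: detQ)
  qed
  then have "poly (char_poly ?A) = poly (\<Prod>i\<in>UNIV. [:- d i, 1:])"
    by (auto simp: poly_prod fun_eq_iff)
  then have "char_poly ?A = (\<Prod>i\<in>UNIV. [:- d i, 1:])"
    by (simp add: poly_eq_poly_eq_iff)
  then have "eigenvalues ?A = (\<Sum>i\<in>UNIV. {#d i#})"
    unfolding eigenvalues_def by (simp add: proots_prod)
  then show ?thesis
    by (simp add: sum_unfold_sum_mset)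
qed

text \<open>Adjacent factors \<open>transpose Q\<close> and \<open>Q\<close> cancel. Besides matrix
  polynomials, the case of exponent 2 evaluates the square in \<open>phi_matrix\<close>.\<close>

lemma matrix_power_orthogonal_diag_conj:
  fixes Q :: "real^'n^'n"
  assumes Q: "orthogonal_matrix Q"
  shows "matrix_power (Q ** diag_matrix d ** transpose Q) k = Q ** diag_matrix (\<lambda>i. d i ^ k) ** transpose Q"
proof -
  have dd: "diag_matrix f ** diag_matrix g = (diag_matrix (\<lambda>i. f i * g i) :: real^'n^'n)" for f g
    by (simp add: matrix_matrix_mult_def vec_eq_iff if_distribR diag_matrix_def if_distrib[of "\<lambda>c. c * _"]
        cong: if_cong)
  have d1: "diag_matrix (\<lambda>i. 1) = (mat 1 :: real^'n^'n)"
    by (simp add: diag_matrix_def mat_def)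
  have QQ: "transpose Q ** (Q ** M) = M" for M :: "real^'n^'n"
    using Q by (simp add: orthogonal_matrix_def matrix_mul_assoc)
  show ?thesis
  proof (induction k)
    case 0
    then show ?case using Q by (simp add: matrix_power_def d1 orthogonal_matrix_def)
  next
    case (Suc k)
    have "matrix_power (Q ** diag_matrix d ** transpose Q) (Suc k) =
      (Q ** diag_matrix d ** transpose Q) ** (Q ** diag_matrix (\<lambda>i. d i ^ k) ** transpose Q)"
      unfolding Suc[symmetric] by (simp add: matrix_power_def)
    also have "\<dots> = Q ** (diag_matrix d ** diag_matrix (\<lambda>i. d i ^ k)) ** transpose Q"
      by (simp add: matrix_mul_assoc[symmetric] QQ)
    finally show ?case by (simp add: dd)
  qed
qed

lemma matrix_poly_orthogonal_diag_conj:
  fixes Q :: "real^'n^'n"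
  assumes Q: "orthogonal_matrix Q"
  shows "matrix_poly f (Q ** diag_matrix d ** transpose Q) = Q ** diag_matrix (\<lambda>i. poly f (d i)) ** transpose Q"
proof -
  have "(\<Sum>l\<le>degree f. coeff f l * (\<Sum>k\<in>UNIV. d k ^ l * Q $ i $ k * Q $ j $ k)) =
      (\<Sum>k\<in>UNIV. poly f (d k) * Q $ i $ k * Q $ j $ k)" for i j
    unfolding poly_altdef sum_distrib_left sum_distrib_right
    by (subst sum.swap) (simp add: mult_ac)
  then show ?thesis
    by (simp add: matrix_poly_def matrix_power_orthogonal_diag_conj[OF Q] vec_eq_iff
        orthogonal_diag_conj_nth)
qed

text \<open>In the coordinates \<open>transpose Q *v x\<close> the quadratic form has no mixed
  terms. Each sample of the estimator thereby becomes a weighted sum of squares.\<close>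

lemma inner_orthogonal_diag_conj:
  fixes Q :: "real^'n^'n"
  shows "x \<bullet> ((Q ** diag_matrix d ** transpose Q) *v x) = (\<Sum>k\<in>UNIV. d k * ((transpose Q *v x) $ k)\<^sup>2)"
proof -
  have dv: "diag_matrix d *v y = (\<chi> i. d i * y $ i)" for y :: "real^'n"
    by (simp add: vec_eq_iff matrix_vector_mult_def diag_matrix_def if_distrib[of "\<lambda>c. c * _"] cong: if_cong)
  have "x \<bullet> ((Q ** diag_matrix d ** transpose Q) *v x) = x \<bullet> (Q *v (diag_matrix d *v (transpose Q *v x)))"
    by (simp only: matrix_vector_mul_assoc matrix_mul_assoc)
  also have "\<dots> = (transpose Q *v x) \<bullet> (diag_matrix d *v (transpose Q *v x))"
    unfolding transpose_matrix_vector dot_lmul_matrix ..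
  finally show ?thesis
    by (simp add: inner_vec_def dv power2_eq_square mult_ac)
qed

section \<open>Error of the Chebyshev approximation\<close>

text \<open>Points of the two circles with the same argument are joined by radial segments. These
  stay in the annulus and form a homotopy of loops.\<close>

lemma contour_integral_annulus_circlepath_eq:
  assumes f: "f holomorphic_on {z. r < norm z \<and> norm z < s}"
    and r: "0 \<le> r" and R: "r < R" "R < s" and R': "r < R'" "R' < s"
  shows "contour_integral (circlepath 0 R) f = contour_integral (circlepath 0 R') f"
proof (rule Cauchy_theorem_homotopic_loops[OF _ _ f])
  show "open {z::complex. r < norm z \<and> norm z < s}"
    by (intro open_Collect_conj open_Collect_less continuous_intros)
  show "homotopic_loops {z. r < norm z \<and> norm z < s} (circlepath 0 R) (circlepath 0 R')"
  proof (rule homotopic_loops_linear)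
    fix t :: real
    show "closed_segment (circlepath 0 R t) (circlepath 0 R' t) \<subseteq> {z. r < norm z \<and> norm z < s}"
    proof
      fix x assume "x \<in> closed_segment (circlepath 0 R t) (circlepath 0 R' t)"
      then obtain u where u: "0 \<le> u" "u \<le> 1"
        and x: "x = (1 - u) *\<^sub>R circlepath 0 R t + u *\<^sub>R circlepath 0 R' t"
        by (auto simp: closed_segment_def)
      have "x = of_real ((1 - u) * R + u * R') * exp (2 * of_real pi * \<i> * of_real t)"
        by (simp add: x circlepath scaleR_conv_of_real algebra_simps)
      moreover have mem: "(1 - u) * R + u * R' \<in> {r<..<s}"
        using convexD[of "{r<..<s}" R R' "1 - u" u] u R R' by auto
      moreover have "norm (exp (2 * of_real pi * \<i> * of_real t)) = 1"
        by simp
      ultimately have "norm x = (1 - u) * R + u * R'"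
        using r by (simp add: norm_mult del: norm_exp_eq_Re of_real_add of_real_mult of_real_diff)
      then show "x \<in> {z. r < norm z \<and> norm z < s}"
        using mem by simp
    qed
  qed auto
qed auto

text \<open>The geometric series is stopped after \<open>n\<close> terms with its exact remainder,
  so no convergence is involved. On the outer circle it is applied as it stands, on the inner circle
  with \<open>z\<close> and \<open>w\<close> exchanged.\<close>

lemma inverse_diff_geometric_expansion:
  fixes z w :: "'a::field"
  assumes "z \<noteq> 0" "z \<noteq> w"
  shows "1 / (z - w) = (\<Sum>j<n. w ^ j / z ^ Suc j) + w ^ n / (z ^ n * (z - w))"
proof (induction n)
  case (Suc n)
  have "w ^ n / (z ^ n * (z - w)) = w ^ n / z ^ Suc n + w ^ Suc n / (z ^ Suc n * (z - w))"
    using assms by (simp add: divide_simps) (simp add: algebra_simps)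
  then show ?case
    using Suc by simp
qed simp

text \<open>Comparing the integrals of \<open>(F z - F w) / (z - w)\<close> over the circles of radii \<open>R\<close> and \<open>1 / R\<close>
  gives Cauchy's formula on the annulus; the kernel \<open>1 / (z - w)\<close> is then expanded into a finite
  geometric sum.\<close>

lemma laurent_partial_sum_error:
  fixes F :: "complex \<Rightarrow> complex"
  assumes F: "F holomorphic_on {z. 1 / \<rho> < norm z \<and> norm z < \<rho>}"
    and B: "\<And>z. 1 / \<rho> < norm z \<Longrightarrow> norm z < \<rho> \<Longrightarrow> norm (F z) \<le> B"
    and R: "1 < R" "R < \<rho>" and w: "norm w = 1"
  defines "c \<equiv> \<lambda>f. contour_integral (circlepath 0 1) f / (2 * of_real pi * \<i>)"
  shows "norm (F w - ((\<Sum>j\<le>N. w ^ j * c (\<lambda>z. F z / z ^ Suc j))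
      + (\<Sum>j<N. c (\<lambda>z. F z * z ^ j) / w ^ Suc j))) \<le> 2 * B / (R ^ N * (R - 1))"
proof -
  define S where "S = {z::complex. 1 / \<rho> < norm z \<and> norm z < \<rho>}"
  define C where "C r = contour_integral (circlepath 0 r)" for r
  have \<rho>: "\<rho> > 1" using R by simp
  have R1: "1 / \<rho> < 1 / R" "1 / R < 1" "1 / R < \<rho>"
    using R by (auto simp: divide_simps intro: less_trans[of _ 1])
      (smt (verit) mult_less_cancel_right1)
  have opS: "open S"
    unfolding S_def by (intro open_Collect_conj open_Collect_less continuous_intros)
  have FS: "F holomorphic_on S" using F by (simp add: S_def)
  have S0: "z \<noteq> 0" if "z \<in> S" for z
    using that \<rho> by (auto simp: S_def)
  have move: "C r f = C r' f" if "f holomorphic_on S" "1 / \<rho> < r" "r < \<rho>" "1 / \<rho> < r'" "r' < \<rho>" for r r' f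
    unfolding C_def using that \<rho> contour_integral_annulus_circlepath_eq[of f "1 / \<rho>" \<rho> r r']
    by (simp add: S_def)
  have integ: "f contour_integrable_on circlepath 0 r"
    if "continuous_on (sphere 0 r) f" "r > 0" for f r
    using that by (intro contour_integrable_continuous_circlepath) simp
  have Fc: "continuous_on (sphere 0 r) F" if "1 / \<rho> < r" "r < \<rho>" for r
    by (rule holomorphic_on_imp_continuous_on, rule holomorphic_on_subset[OF FS])
      (use that in \<open>auto simp: S_def\<close>)
  have B0: "0 \<le> B"
    using order_trans[OF norm_ge_zero B[of w]] w \<rho> by simp
  have pR: "1 / \<rho> < R" "1 / \<rho> < 1"
    using \<rho> R by (auto simp: divide_simps intro: less_trans[of _ 1])
      (smt (verit) mult_less_cancel_right1)
  \<comment> \<open>The value at \<open>w\<close> removes the singularity, so \<open>G\<close> is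
    holomorphic on the whole annulus and has the same integral over both circles.\<close>
  define G where "G = (\<lambda>z. if z = w then deriv F w else (F z - F w) / (z - w))"
  have G: "G holomorphic_on S"
    unfolding G_def using pole_lemma_open[OF FS opS] .
  have CG: "C R G = C (1 / R) G"
    by (rule move[OF G pR(1) R(2) R1(1) R1(3)])
  have ne: "z \<noteq> w" if "norm z = r" "r \<noteq> 1" for z r
    using that w by auto
  have splitG: "C r G = C r (\<lambda>z. F z / (z - w)) - C r (\<lambda>z. F w / (z - w))"
    if r: "1 / \<rho> < r" "r < \<rho>" "r \<noteq> 1" for r
  proof -
    have r0: "r > 0" using r \<rho> by (auto intro: less_trans[of 0 "1/\<rho>"])
    have "C r G = C r (\<lambda>z. F z / (z - w) - F w / (z - w))"
      unfolding C_def by (rule contour_integral_cong)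
        (use r0 ne r in \<open>auto simp: G_def diff_divide_distrib\<close>)
    also have "\<dots> = C r (\<lambda>z. F z / (z - w)) - C r (\<lambda>z. F w / (z - w))"
      unfolding C_def using r0 ne r
      by (intro contour_integral_diff integ continuous_intros Fc) auto
    finally show ?thesis .
  qed
  \<comment> \<open>The point \<open>w\<close> lies inside the circle of radius \<open>R\<close> and
    outside that of radius \<open>1 / R\<close>; hence one kernel integral is
    \<open>2 * of_real pi * \<i> * F w\<close> and the other is zero.\<close>
  have CR: "C R (\<lambda>z. F w / (z - w)) = 2 * of_real pi * \<i> * F w"
    unfolding C_def
    by (intro contour_integral_unique Cauchy_integral_circlepath_simple[of "\<lambda>_. F w"])
      (use w R in \<open>auto simp: dist_norm\<close>)
  have C1R: "C (1 / R) (\<lambda>z. F w / (z - w)) = 0"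
    unfolding C_def
    by (intro contour_integral_unique Cauchy_theorem_disc_simple[of _ 0 1] holomorphic_intros)
      (use w R R1 in \<open>auto simp: dist_norm\<close>)
  have main: "2 * of_real pi * \<i> * F w = C R (\<lambda>z. F z / (z - w)) - C (1 / R) (\<lambda>z. F z / (z - w))"
    using CG splitG[of R] splitG[of "1 / R"] CR C1R R R1 pR by (auto simp: algebra_simps)
  \<comment> \<open>Taking \<open>Suc N\<close> terms gives the powers 0 to \<open>N\<close> of
    \<open>w\<close>. The coefficient integrals move to the unit circle; only the remainder stays at
    radius \<open>R\<close>, where it is small.\<close>
  have E1: "C R (\<lambda>z. F z / (z - w)) = (\<Sum>j\<le>N. w ^ j * C 1 (\<lambda>z. F z / z ^ Suc j))
      + C R (\<lambda>z. F z * (w ^ Suc N / (z ^ Suc N * (z - w))))"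
  proof -
    have "C R (\<lambda>z. F z / (z - w)) = C R (\<lambda>z. (\<Sum>j\<le>N. w ^ j * (F z / z ^ Suc j))
        + F z * (w ^ Suc N / (z ^ Suc N * (z - w))))"
      unfolding C_def
    proof (rule contour_integral_cong[OF refl])
      fix z assume "z \<in> path_image (circlepath 0 R)"
      then have "z \<noteq> 0" "z \<noteq> w" using R w by auto
      from inverse_diff_geometric_expansion[OF this, of "Suc N"]
      have "F z * (1 / (z - w)) = F z * ((\<Sum>j\<le>N. w ^ j / z ^ Suc j) + w ^ Suc N / (z ^ Suc N * (z - w)))"
        by (simp only: lessThan_Suc_atMost)
      then show "F z / (z - w) = (\<Sum>j\<le>N. w ^ j * (F z / z ^ Suc j))
        + F z * (w ^ Suc N / (z ^ Suc N * (z - w)))"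
        by (simp add: distrib_left sum_distrib_left mult_ac)
    qed
    also have "\<dots> = C R (\<lambda>z. \<Sum>j\<le>N. w ^ j * (F z / z ^ Suc j))
        + C R (\<lambda>z. F z * (w ^ Suc N / (z ^ Suc N * (z - w))))"
      unfolding C_def
      by (intro contour_integral_add integ continuous_intros Fc) (use R ne in \<open>auto intro: pR R1\<close>)
    also have "C R (\<lambda>z. \<Sum>j\<le>N. w ^ j * (F z / z ^ Suc j)) = (\<Sum>j\<le>N. C R (\<lambda>z. w ^ j * (F z / z ^ Suc j)))"
      unfolding C_def
      by (intro contour_integral_sum integ continuous_intros Fc) (use R ne in \<open>auto intro: pR R1\<close>)
    also have "\<dots> = (\<Sum>j\<le>N. w ^ j * C R (\<lambda>z. F z / z ^ Suc j))"
      unfolding C_def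
      by (intro sum.cong refl contour_integral_lmul integ continuous_intros Fc) (use R ne in \<open>auto intro: pR R1\<close>)
    also have "\<dots> = (\<Sum>j\<le>N. w ^ j * C 1 (\<lambda>z. F z / z ^ Suc j))"
      by (intro sum.cong refl arg_cong2[where f="(*)"] move holomorphic_intros FS)
        (use R S0 in \<open>auto intro: pR R1\<close>)
    finally show ?thesis .
  qed
  \<comment> \<open>Here \<open>z\<close> is the smaller point. Taking \<open>N\<close> terms gives
    the powers -1 to \<open>-N\<close> of \<open>w\<close>, so that together with \<open>E1\<close>
    the range of exponents is symmetric.\<close>
  have E2: "C (1 / R) (\<lambda>z. F z / (z - w)) = - ((\<Sum>j<N. C 1 (\<lambda>z. F z * z ^ j) / w ^ Suc j)
      + C (1 / R) (\<lambda>z. F z * (z ^ N / (w ^ N * (w - z)))))"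
  proof -
    have w0: "w \<noteq> 0" using w by auto
    have R0: "1 / R > 0" using R by simp
    have "C (1 / R) (\<lambda>z. F z / (z - w)) = C (1 / R) (\<lambda>z. - ((\<Sum>j<N. (F z * z ^ j) / w ^ Suc j)
        + F z * (z ^ N / (w ^ N * (w - z)))))"
      unfolding C_def
    proof (rule contour_integral_cong[OF refl])
      fix z assume "z \<in> path_image (circlepath 0 (1 / R))"
      then have "w \<noteq> z" using R R0 w by auto
      from inverse_diff_geometric_expansion[OF w0 this, of N]
      have "F z * (1 / (w - z)) = F z * ((\<Sum>j<N. z ^ j / w ^ Suc j) + z ^ N / (w ^ N * (w - z)))"
        by (simp only:)
      moreover have "F z / (z - w) = - (F z * (1 / (w - z)))"
        using \<open>w \<noteq> z\<close> by (simp add: divide_simps) (simp add: algebra_simps)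
      ultimately show "F z / (z - w) = - ((\<Sum>j<N. (F z * z ^ j) / w ^ Suc j)
        + F z * (z ^ N / (w ^ N * (w - z))))"
        by (simp add: distrib_left sum_distrib_left mult_ac)
    qed
    also have "\<dots> = - C (1 / R) (\<lambda>z. (\<Sum>j<N. (F z * z ^ j) / w ^ Suc j)
        + F z * (z ^ N / (w ^ N * (w - z))))"
      unfolding C_def
      by (rule contour_integral_neg)
    also have "C (1 / R) (\<lambda>z. (\<Sum>j<N. (F z * z ^ j) / w ^ Suc j)
        + F z * (z ^ N / (w ^ N * (w - z)))) = C (1 / R) (\<lambda>z. (\<Sum>j<N. (F z * z ^ j) / w ^ Suc j))
        + C (1 / R) (\<lambda>z. F z * (z ^ N / (w ^ N * (w - z))))"
      unfolding C_def
      by (intro contour_integral_add integ continuous_intros Fc) (use R R1 w0 w in \<open>auto intro: pR R1\<close>)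
    also have "C (1 / R) (\<lambda>z. \<Sum>j<N. (F z * z ^ j) / w ^ Suc j) = (\<Sum>j<N. C (1 / R) (\<lambda>z. (F z * z ^ j) / w ^ Suc j))"
      unfolding C_def
      by (intro contour_integral_sum integ continuous_intros Fc) (use R R1 w0 in \<open>auto intro: pR R1\<close>)
    also have "\<dots> = (\<Sum>j<N. C (1 / R) (\<lambda>z. F z * z ^ j) / w ^ Suc j)"
      unfolding C_def
      by (intro sum.cong refl contour_integral_div integ continuous_intros Fc) (use R R1 w0 in \<open>auto intro: pR R1\<close>)
    also have "\<dots> = (\<Sum>j<N. C 1 (\<lambda>z. F z * z ^ j) / w ^ Suc j)"
      by (intro sum.cong refl arg_cong2[where f="(/)"] move holomorphic_intros FS)
        (use R R1 in \<open>auto intro: pR R1\<close>)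
    finally show ?thesis .
  qed
  let ?E1 = "C R (\<lambda>z. F z * (w ^ Suc N / (z ^ Suc N * (z - w))))"
  let ?E2 = "C (1 / R) (\<lambda>z. F z * (z ^ N / (w ^ N * (w - z))))"
  have b1: "norm ?E1 \<le> B * (1 / (R ^ Suc N * (R - 1))) * (2 * pi * R)"
  proof (rule has_contour_integral_bound_circlepath)
    show "((\<lambda>z. F z * (w ^ Suc N / (z ^ Suc N * (z - w)))) has_contour_integral ?E1) (circlepath 0 R)"
      unfolding C_def
      by (intro has_contour_integral_integral integ continuous_intros Fc) (use R ne in \<open>auto intro: pR R1\<close>)
    fix z :: complex assume z: "norm (z - 0) = R"
    have "R - 1 \<le> norm (z - w)"
      using norm_triangle_ineq2[of z w] z w by simp
    then have "norm (w ^ Suc N / (z ^ Suc N * (z - w))) \<le> 1 / (R ^ Suc N * (R - 1))"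
      using R z w by (simp add: norm_divide norm_mult norm_power frac_le mult_left_mono del: power_Suc)
    moreover have "norm (F z) \<le> B"
      using z R(2) pR(1) by (intro B) simp_all
    ultimately show "norm (F z * (w ^ Suc N / (z ^ Suc N * (z - w)))) \<le> B * (1 / (R ^ Suc N * (R - 1)))"
      unfolding norm_mult using B0 by (intro mult_mono) auto
  qed (use B0 R in \<open>auto intro: pR R1\<close>)
  have b2: "norm ?E2 \<le> B * ((1 / R) ^ N / (1 - 1 / R)) * (2 * pi * (1 / R))"
  proof (rule has_contour_integral_bound_circlepath)
    show "((\<lambda>z. F z * (z ^ N / (w ^ N * (w - z)))) has_contour_integral ?E2) (circlepath 0 (1 / R))"
      unfolding C_def
      by (intro has_contour_integral_integral integ continuous_intros Fc) (use R R1 w in \<open>auto intro: pR R1\<close>)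
    fix z :: complex assume z: "norm (z - 0) = 1 / R"
    have "1 - 1 / R \<le> norm (w - z)"
      using norm_triangle_ineq2[of w z] z w by simp
    then have "norm (z ^ N / (w ^ N * (w - z))) \<le> (1 / R) ^ N / (1 - 1 / R)"
      using R R1 z w by (simp add: norm_divide norm_mult norm_power frac_le mult_left_mono)
    moreover have "norm (F z) \<le> B"
      using z R1(1,3) by (intro B) simp_all
    ultimately show "norm (F z * (z ^ N / (w ^ N * (w - z)))) \<le> B * ((1 / R) ^ N / (1 - 1 / R))"
      unfolding norm_mult using B0 by (intro mult_mono) auto
  qed (use B0 R R1 in \<open>auto intro: pR R1\<close>)
  have "F w - ((\<Sum>j\<le>N. w ^ j * c (\<lambda>z. F z / z ^ Suc j)) + (\<Sum>j<N. c (\<lambda>z. F z * z ^ j) / w ^ Suc j))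
     = (?E1 + ?E2) / (2 * of_real pi * \<i>)"
  proof -
    have "F w = (2 * of_real pi * \<i> * F w) / (2 * of_real pi * \<i>)"
      by simp
    also have "\<dots> = (C R (\<lambda>z. F z / (z - w)) - C (1 / R) (\<lambda>z. F z / (z - w))) / (2 * of_real pi * \<i>)"
      by (simp only: main)
    also have "\<dots> = (\<Sum>j\<le>N. w ^ j * c (\<lambda>z. F z / z ^ Suc j)) + (\<Sum>j<N. c (\<lambda>z. F z * z ^ j) / w ^ Suc j)
       + (?E1 + ?E2) / (2 * of_real pi * \<i>)"
      unfolding E1 E2 c_def C_def[symmetric]
      by (simp add: add_divide_distrib sum_divide_distrib diff_divide_distrib mult_ac)
    finally show ?thesis by simp
  qed
  then have "norm (F w - ((\<Sum>j\<le>N. w ^ j * c (\<lambda>z. F z / z ^ Suc j)) + (\<Sum>j<N. c (\<lambda>z. F z * z ^ j) / w ^ Suc j)))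
     \<le> (B * (1 / (R ^ Suc N * (R - 1))) * (2 * pi * R) + B * ((1 / R) ^ N / (1 - 1 / R)) * (2 * pi * (1 / R))) / (2 * pi)"
    using norm_triangle_le[of ?E1 ?E2] b1 b2
    by (simp add: norm_divide norm_mult divide_right_mono)
  \<comment> \<open>After the circle lengths are inserted and \<open>2 * pi\<close> is divided out,
    both remainders have the same bound \<open>B / (R ^ N * (R - 1))\<close>.\<close>
  also have "\<dots> = 2 * B / (R ^ N * (R - 1))"
  proof -
    have "B * (1 / (R ^ Suc N * (R - 1))) * (2 * pi * R) / (2 * pi) = B / (R ^ N * (R - 1))"
      using R by (simp add: divide_simps)
    moreover have "B * ((1 / R) ^ N / (1 - 1 / R)) * (2 * pi * (1 / R)) / (2 * pi) = B / (R ^ N * (R - 1))"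
      using R by (simp add: power_divide divide_simps)
    ultimately show ?thesis
      unfolding add_divide_distrib by simp
  qed
  finally show ?thesis .
qed

text \<open>Substituting \<open>2 * pi - t\<close> folds the second half of the period onto the
  first and, as \<open>k\<close> is an integer, replaces \<open>cis\<close> by its conjugate; the
  imaginary parts cancel. This turns Laurent coefficients on the unit circle into the cosine
  integrals of \<open>chebyshev_coeff\<close>.\<close>

lemma integral_symmetric_cis:
  fixes h :: "real \<Rightarrow> real" and k :: int
  assumes h: "continuous_on UNIV h" and sym: "\<And>t. h (2 * pi - t) = h t"
  shows "integral {0..2 * pi} (\<lambda>t. of_real (h t) * cis (of_int k * t)) =
    of_real (2 * integral {0..pi} (\<lambda>t. h t * cos (of_int k * t)))"
proof -
  define f where "f t = complex_of_real (h t) * cis (of_int k * t)" for t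
  have fc: "continuous_on S f" for S
    unfolding f_def cis_conv_exp by (intro continuous_intros continuous_on_subset[OF h]) auto
  have refl: "f t + f (2 * pi - t) = of_real (2 * (h t * cos (of_int k * t)))" for t
  proof -
    have "cis (of_int k * (2 * pi - t)) = cis (2 * pi * of_int k) * cis (- (of_int k * t))"
      by (simp add: cis_mult algebra_simps)
    then have "cis (of_int k * (2 * pi - t)) = cis (- (of_int k * t))"
      by (simp add: cis_multiple_2pi)
    then have "f t + f (2 * pi - t) = of_real (h t) * (cis (of_int k * t) + cis (- (of_int k * t)))"
      by (simp add: f_def sym distrib_left)
    also have "cis (of_int k * t) + cis (- (of_int k * t)) = of_real (2 * cos (of_int k * t))"
      by (simp add: complex_eq_iff)
    finally show ?thesis by simp
  qed
  have "(f has_integral integral {pi..2*pi} f) (cbox pi (2*pi))"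
    using fc by (simp add: integrable_integral integrable_continuous_interval)
  from has_integral_affinity[OF this, of "-1" "2*pi"]
  have "((\<lambda>x. f (2 * pi - x)) has_integral integral {pi..2*pi} f) ((\<lambda>x. 2 * pi - x) ` {pi..2*pi})"
    by simp
  moreover have "(\<lambda>x. 2 * pi - x) ` {pi..2*pi} = {0..pi}"
    by auto
  ultimately have 1: "((\<lambda>x. f (2 * pi - x)) has_integral integral {pi..2*pi} f) {0..pi}"
    by simp
  have "(f has_integral integral {0..pi} f) {0..pi}"
    using fc by (simp add: integrable_integral integrable_continuous_interval)
  from has_integral_add[OF this 1]
  have "((\<lambda>t. complex_of_real (2 * (h t * cos (of_int k * t)))) has_integral
      integral {0..pi} f + integral {pi..2*pi} f) {0..pi}"
    by (simp only: refl)
  moreover have "((\<lambda>t. h t * cos (of_int k * t)) has_integral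
      integral {0..pi} (\<lambda>t. h t * cos (of_int k * t))) {0..pi}"
    by (intro integrable_integral integrable_continuous_interval continuous_intros
        continuous_on_subset[OF h]) auto
  from has_integral_linear[OF has_integral_mult_right[OF this, of 2] bounded_linear_of_real[where 'a=complex]]
  have "((\<lambda>t. complex_of_real (2 * (h t * cos (of_int k * t)))) has_integral
      of_real (2 * integral {0..pi} (\<lambda>t. h t * cos (of_int k * t)))) {0..pi}"
    by (simp add: comp_def)
  ultimately have "integral {0..pi} f + integral {pi..2*pi} f =
      of_real (2 * integral {0..pi} (\<lambda>t. h t * cos (of_int k * t)))"
    by (rule has_integral_unique)
  moreover have "integral {0..pi} f + integral {pi..2*pi} f = integral {0..2*pi} f"
    by (rule Henstock_Kurzweil_Integration.integral_combine) (use fc in \<open>auto intro: integrable_continuous_interval\<close>)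
  ultimately show ?thesis by (simp flip: f_def)
qed

text \<open>On the unit circle \<open>F (cis t)\<close> is even in \<open>t\<close>, so Laurent
  coefficients of opposite index agree. Since \<open>w ^ j + 1 / w ^ j\<close> is twice a cosine,
  the Laurent sum from \<open>-N\<close> to \<open>N\<close> is the Chebyshev partial sum.
  \<open>F\<close> is controlled on the open annulus, so the error is estimated for each
  \<open>R < \<rho>\<close> and the limit is taken last.\<close>

theorem chebyshev_approx_error:
  fixes F :: "complex \<Rightarrow> complex" and g :: "real \<Rightarrow> real"
  assumes ab: "a < b" and \<rho>: "1 < \<rho>"
    and F: "F holomorphic_on {z. 1 / \<rho> < norm z \<and> norm z < \<rho>}"
    and B: "\<And>z. 1 / \<rho> < norm z \<Longrightarrow> norm z < \<rho> \<Longrightarrow> norm (F z) \<le> B"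
    and Fg: "\<And>t. F (cis t) = of_real (g ((b - a) / 2 * cos t + (b + a) / 2))"
    and x: "x \<in> {a..b}"
  shows "\<bar>poly (chebyshev_approx g a b N) x - g x\<bar> \<le> 2 * B / (\<rho> ^ N * (\<rho> - 1))"
proof -
  define h where "h t = g ((b - a) / 2 * cos t + (b + a) / 2)" for t
  define m where "m j = integral {0..pi} (\<lambda>t. h t * cos (real j * t))" for j
  \<comment> \<open>\<open>y\<close> is \<open>x\<close> carried affinely to \<open>{-1..1}\<close>,
    and \<open>w\<close> is a point of the unit circle with real part \<open>y\<close>.\<close>
  define y where "y = - ((b + a) / (b - a)) + x * (2 / (b - a))"
  define \<theta> where "\<theta> = arccos y"
  define w where "w = cis \<theta>"
  define c where "c f = contour_integral (circlepath 0 1) f / (2 * of_real pi * \<i>)" for f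
  have y_eq: "y = (2 * x - (b + a)) / (b - a)"
    by (simp add: y_def diff_divide_distrib)
  have y: "y \<in> {-1..1}"
    using x ab by (auto simp: y_eq divide_simps)
  have cos\<theta>: "cos \<theta> = y"
    using y by (simp add: \<theta>_def)
  have Fw: "F w = of_real (g x)"
  proof -
    have "(b - a) / 2 * y + (b + a) / 2 = x"
      using ab by (simp add: y_eq field_simps)
    then show ?thesis by (simp add: w_def Fg cos\<theta>)
  qed
  have h_eq: "complex_of_real (h t) = F (cis t)" for t
    by (simp add: h_def Fg)
  have hc: "continuous_on UNIV h"
  proof -
    have "continuous_on (sphere 0 1) F"
      by (rule holomorphic_on_imp_continuous_on, rule holomorphic_on_subset[OF F])
        (use \<rho> in auto)
    then have "continuous_on UNIV (\<lambda>t. F (cis t))"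
      by (rule continuous_on_compose2) (auto simp: cis_conv_exp intro!: continuous_intros)
    then have "continuous_on UNIV (\<lambda>t. Re (F (cis t)))"
      by (intro continuous_intros)
    then show ?thesis by (simp flip: h_eq)
  qed
  have hsym: "h (2 * pi - t) = h t" for t
    by (simp add: h_def)
  have c_eq: "c f = integral {0..2*pi} (\<lambda>t. f (cis t) * \<i> * cis t) / (2 * of_real pi * \<i>)" for f
    using contour_integral_part_circlepath_eq[of 0 "2 * pi" 0 1 f]
    by (simp add: c_def circlepath_def)
  have cis_pow: "cis t ^ n = cis (real n * t)" for t n
    by (rule Complex.DeMoivre)
  have cm: "c f = of_real (m j / pi)"
    if "\<And>t. f (cis t) * \<i> * cis t = \<i> * (of_real (h t) * cis (of_int k * t))" "\<bar>k\<bar> = int j" for f j k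
  proof -
    have "c f = integral {0..2*pi} (\<lambda>t. \<i> * (of_real (h t) * cis (of_int k * t))) / (2 * of_real pi * \<i>)"
      by (simp only: c_eq that)
    also have "\<dots> = integral {0..2*pi} (\<lambda>t. of_real (h t) * cis (of_int k * t)) / (2 * of_real pi)"
      by simp
    also have "\<dots> = of_real (integral {0..pi} (\<lambda>t. h t * cos (of_int k * t)) / pi)"
      by (subst integral_symmetric_cis[OF hc hsym]) simp
    also have "(\<lambda>t. h t * cos (of_int k * t)) = (\<lambda>t. h t * cos (real j * t))"
    proof -
      have "k = int j \<or> k = - int j" using that(2) by linarith
      then show ?thesis by auto
    qed
    finally show ?thesis by (simp add: m_def)
  qed
  \<comment> \<open>The factor \<open>cis t\<close> from the parametrisation shifts exponents by
    one: \<open>z ^ Suc j\<close> in the denominator yields index \<open>j\<close>, while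
    multiplication by \<open>z ^ j\<close> yields index \<open>Suc j\<close>.\<close>
  have c1: "c (\<lambda>z. F z / z ^ Suc j) = of_real (m j / pi)" for j
  proof (rule cm)
    show "F (cis t) / cis t ^ Suc j * \<i> * cis t = \<i> * (of_real (h t) * cis (of_int (- int j) * t))" for t
      by (simp add: h_eq cis_pow divide_simps cis_mult flip: power_Suc)
        (simp add: cis_mult algebra_simps)
  qed simp
  have c2: "c (\<lambda>z. F z * z ^ j) = of_real (m (Suc j) / pi)" for j
  proof (rule cm)
    show "F (cis t) * cis t ^ j * \<i> * cis t = \<i> * (of_real (h t) * cis (of_int (int (Suc j)) * t))" for t
      by (simp add: h_eq cis_pow cis_mult algebra_simps)
  qed simp
  have poly_eq: "of_real (poly (chebyshev_approx g a b N) x) =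
      (\<Sum>j\<le>N. w ^ j * c (\<lambda>z. F z / z ^ Suc j)) + (\<Sum>j<N. c (\<lambda>z. F z * z ^ j) / w ^ Suc j)"
  proof -
    have w_pow: "w ^ j + 1 / w ^ j = of_real (2 * cos (real j * \<theta>))" for j
      by (simp add: w_def cis_pow complex_eq_iff cis_divide[of 0, simplified])
    have "poly (chebyshev_approx g a b N) x = m 0 / pi + (\<Sum>j=1..N. m j / pi * (2 * cos (real j * \<theta>)))"
    proof -
      have lin: "poly [:- ((b + a) / (b - a)), 2 / (b - a):] x = y"
        by (simp add: y_def)
      have "poly (chebyshev_approx g a b N) x = poly [:chebyshev_coeff g a b 0:] x +
          (\<Sum>j=1..N. chebyshev_coeff g a b j * cos (real j * \<theta>))"
        by (simp only: chebyshev_approx_def poly_add poly_sum poly_smult poly_pcompose lin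
            poly_chebyshev_T[OF y] \<theta>_def)
      \<comment> \<open>For positive \<open>j\<close> the factor 2 is shared by \<open>w ^ j\<close>
        and \<open>1 / w ^ j\<close>; the constant term occurs only once, which matches the halved
        normalisation at index 0.\<close>
      moreover have "chebyshev_coeff g a b j = 2 / pi * m j" if "j \<in> {1..N}" for j
        using that by (simp add: chebyshev_coeff_def m_def h_def)
      moreover have "chebyshev_coeff g a b 0 = m 0 / pi"
        by (simp add: chebyshev_coeff_def m_def h_def)
      ultimately show ?thesis
        by (simp add: mult_ac)
    qed
    then have "of_real (poly (chebyshev_approx g a b N) x) =
        of_real (m 0 / pi) + (\<Sum>j=1..N. of_real (m j / pi) * (w ^ j + 1 / w ^ j))"
      unfolding w_pow by simp
    also have "\<dots> = (of_real (m 0 / pi) + (\<Sum>j=1..N. of_real (m j / pi) * w ^ j)) +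
        (\<Sum>j=1..N. of_real (m j / pi) / w ^ j)"
      by (simp add: distrib_left sum.distrib)
    also have "of_real (m 0 / pi) + (\<Sum>j=1..N. of_real (m j / pi) * w ^ j) = (\<Sum>j\<le>N. w ^ j * of_real (m j / pi))"
      by (simp add: atMost_atLeast0 sum.atLeast_Suc_atMost mult.commute)
    also have "(\<Sum>j=1..N. of_real (m j / pi) / w ^ j) = (\<Sum>j<N. of_real (m (Suc j) / pi) / w ^ Suc j)"
      by (rule sum.reindex_bij_witness[of _ Suc "\<lambda>j. j - 1"]) auto
    finally show ?thesis by (simp only: c1 c2)
  qed
  have ineq: "\<bar>poly (chebyshev_approx g a b N) x - g x\<bar> \<le> 2 * B / (R ^ N * (R - 1))"
    if "1 < R" "R < \<rho>" for R
  proof -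
    have "norm (F w - of_real (poly (chebyshev_approx g a b N) x)) \<le> 2 * B / (R ^ N * (R - 1))"
      unfolding poly_eq c_def
      by (rule laurent_partial_sum_error[OF F B]) (use that in \<open>auto simp: w_def\<close>)
    moreover have "F w - of_real (poly (chebyshev_approx g a b N) x) =
      of_real (g x - poly (chebyshev_approx g a b N) x)"
      by (simp add: Fw)
    ultimately show ?thesis
      by (simp only: norm_of_real abs_minus_commute)
  qed
  have "((\<lambda>R. 2 * B / (R ^ N * (R - 1))) \<longlongrightarrow> 2 * B / (\<rho> ^ N * (\<rho> - 1))) (at_left \<rho>)"
    using \<rho> by (intro tendsto_intros) auto
  moreover have "\<forall>\<^sub>F R in at_left \<rho>. \<bar>poly (chebyshev_approx g a b N) x - g x\<bar> \<le> 2 * B / (R ^ N * (R - 1))"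
    using ineq \<rho> by (auto simp: eventually_at_left)
  ultimately show ?thesis
    by (rule tendsto_lowerbound) simp
qed

text \<open>The function \<open>(b - a) / 4 * (z + 1 / z) + (b + a) / 2\<close> factors as
  \<open>K * (1 + r * z) * (1 + r / z)\<close> with \<open>r = 1 / \<rho>\<close>. On the annulus
  both non-constant factors lie in the unit disc about 1, away from the branch cut, so the product
  of their principal powers is the required holomorphic extension.\<close>

lemma psi_error:
  fixes a b p \<kappa> x :: real
  assumes a: "0 < a" and ab: "a < b" and p: "0 \<le> p" and \<kappa>: "\<kappa> = sqrt (b / a)" and x: "x \<in> {a..b}"
  shows "\<bar>poly (psi p a b N) x - x powr (p / 2)\<bar>
    \<le> (a + b) powr (p / 2) * (\<kappa> - 1) / ((\<kappa> + 1) / (\<kappa> - 1)) ^ N"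
proof -
  define q where "q = p / 2"
  define r where "r = (\<kappa> - 1) / (\<kappa> + 1)"
  define \<rho> where "\<rho> = (\<kappa> + 1) / (\<kappa> - 1)"
  \<comment> \<open>\<open>K\<close> comes from matching the constant term and the cosine
    coefficient of the factorisation, which are \<open>K1\<close> and \<open>K2\<close>.\<close>
  define K where "K = a * (\<kappa> + 1)\<^sup>2 / 4"
  have q: "0 \<le> q" using p by (simp add: q_def)
  have \<kappa>1: "\<kappa> > 1" using a ab by (simp add: \<kappa>)
  have b: "b = a * \<kappa>\<^sup>2" using a ab by (simp add: \<kappa>)
  have r: "0 < r" "r < 1" using \<kappa>1 by (auto simp: r_def)
  have \<rho>1: "1 < \<rho>" using \<kappa>1 by (simp add: \<rho>_def divide_simps)
  have r\<rho>: "1 / \<rho> = r" "\<rho> = 1 / r" by (simp_all add: r_def \<rho>_def)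
  have K0: "K > 0" using a \<kappa>1 by (simp add: K_def)
  have K1: "K * (1 + r\<^sup>2) = (b + a) / 2" and K2: "K * (2 * r) = (b - a) / 2"
    using \<kappa>1 by (simp_all add: K_def r_def b divide_simps power2_eq_square) algebra+
  define F where "F z = of_real (K powr q) * ((1 + of_real r * z) powr of_real q * (1 + of_real r / z) powr of_real q)"
    for z :: complex
  have re: "Re u > 0" if "norm (u - 1) < 1" for u
    using abs_Re_le_cmod[of "u - 1"] that by simp
  have small: "norm (of_real r * z) < 1" "norm (of_real r / z) < 1" if "1 / \<rho> < norm z" "norm z < \<rho>" for z :: complex
  proof -
    have "r < norm z" "norm z < 1 / r" using that r\<rho> by auto
    moreover from this have "0 < norm z" using r by linarith
    ultimately show "norm (of_real r * z) < 1" "norm (of_real r / z) < 1"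
      using r by (simp_all add: norm_mult norm_divide divide_less_eq less_divide_eq mult.commute)
  qed
  have pos: "1 + of_real r * z \<notin> \<real>\<^sub>\<le>\<^sub>0" "1 + of_real r / z \<notin> \<real>\<^sub>\<le>\<^sub>0" "z \<noteq> 0"
    if "1 / \<rho> < norm z" "norm z < \<rho>" for z :: complex
  proof -
    show "1 + of_real r * z \<notin> \<real>\<^sub>\<le>\<^sub>0" "1 + of_real r / z \<notin> \<real>\<^sub>\<le>\<^sub>0"
      using re[of "1 + of_real r * z"] re[of "1 + of_real r / z"] small[OF that]
      by (auto simp: complex_nonpos_Reals_iff)
    show "z \<noteq> 0" using that \<rho>1 by auto
  qed
  have "\<bar>poly (chebyshev_approx (\<lambda>x. x powr q) a b N) x - x powr q\<bar> \<le> 2 * (a + b) powr q / (\<rho> ^ N * (\<rho> - 1))"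
  proof (rule chebyshev_approx_error[OF ab \<rho>1 _ _ _ x])
    show "F holomorphic_on {z. 1 / \<rho> < norm z \<and> norm z < \<rho>}"
      unfolding F_def by (intro holomorphic_intros) (use pos in auto)
  next
    fix z :: complex assume z: "1 / \<rho> < norm z" "norm z < \<rho>"
    have nz: "r < norm z" "r * norm z < 1"
      using z r by (simp_all add: r\<rho>(1)) (simp add: r\<rho>(2) divide_simps mult.commute)
    have "norm (1 + of_real r * z) * norm (1 + of_real r / z) \<le> (1 + r * norm z) * (1 + r / norm z)"
      using norm_triangle_ineq[of 1 "of_real r * z"] norm_triangle_ineq[of 1 "of_real r / z"] r
      by (intro mult_mono) (auto simp: norm_mult norm_divide)
    also have "\<dots> \<le> 2 * (1 + r\<^sup>2)"
    proof -
      \<comment> \<open>The annulus enters through this sign: it says that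
        \<open>norm z + 1 / norm z\<close> does not exceed its value at the boundary radii
        \<open>r\<close> and \<open>1 / r\<close>.\<close>
      have "(norm z - r) * (1 - r * norm z) \<ge> 0" using nz by simp
      then have "r * (norm z)\<^sup>2 + r \<le> (1 + r\<^sup>2) * norm z"
        by (simp add: algebra_simps power2_eq_square)
      then have "r * norm z + r / norm z \<le> 1 + r\<^sup>2"
      proof -
        have n0: "norm z > 0" using nz r by linarith
        then have "r * norm z + r / norm z = (r * (norm z)\<^sup>2 + r) / norm z"
          by (simp add: field_simps power2_eq_square)
        also have "\<dots> \<le> 1 + r\<^sup>2"
          using n0 \<open>r * (norm z)\<^sup>2 + r \<le> _\<close> by (simp add: divide_le_eq)
        finally show ?thesis .
      qed
      moreover have eq: "(1 + r * norm z) * (1 + r / norm z) = 1 + r\<^sup>2 + (r * norm z + r / norm z)"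
        using pos(3)[OF z] by (simp add: field_simps power2_eq_square)
      ultimately show ?thesis unfolding eq by simp
    qed
    finally have le: "norm (1 + of_real r * z) * norm (1 + of_real r / z) \<le> 2 * (1 + r\<^sup>2)" .
    have "norm (F z) = K powr q * (norm (1 + of_real r * z) * norm (1 + of_real r / z)) powr q"
      by (simp add: F_def norm_mult norm_powr_real_powr' powr_mult)
    also have "\<dots> \<le> K powr q * (2 * (1 + r\<^sup>2)) powr q"
      using le q by (intro mult_left_mono powr_mono2) auto
    also have "\<dots> = (a + b) powr q"
    proof -
      have "K powr q * c powr q = (K * c) powr q" if "0 \<le> c" for c
        using K0 that by (simp add: powr_mult)
      moreover have "K * (2 * (1 + r\<^sup>2)) = a + b"
        using K1 by (simp add: algebra_simps)
      ultimately show ?thesis by simp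
    qed
    finally show "norm (F z) \<le> (a + b) powr q" .
  next
    fix t
    \<comment> \<open>On the unit circle \<open>1 / z\<close> is the conjugate of \<open>z\<close>,
      so the two factors are conjugate and the product of their powers is real.\<close>
    define u where "u = 1 + of_real r * cis t"
    have u1: "1 + of_real r / cis t = cnj u"
      by (simp add: u_def cis_cnj divide_inverse cis_inverse)
    have "Re u > 0"
      by (rule re) (use r in \<open>simp add: u_def norm_mult\<close>)
    then have "cnj u powr of_real q = cnj (u powr of_real q)"
      by (subst cnj_powr) auto
    then have "F (cis t) = of_real (K powr q) * (u powr of_real q * cnj (u powr of_real q))"
      by (simp add: F_def u1 flip: u_def)
    also have "\<dots> = of_real (K powr q * (norm (u powr of_real q))\<^sup>2)"
      by (simp only: complex_norm_square[symmetric] of_real_mult)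
    also have "(norm (u powr of_real q))\<^sup>2 = ((norm u)\<^sup>2) powr q"
      by (simp add: norm_powr_real_powr' power2_eq_square powr_mult)
    also have "(norm u)\<^sup>2 = 1 + r\<^sup>2 + 2 * r * cos t"
      unfolding cmod_power2 by (simp add: u_def power2_eq_square algebra_simps)
        (metis distrib_left mult.right_neutral power2_eq_square sin_cos_squared_add3)
    also have "K powr q * (1 + r\<^sup>2 + 2 * r * cos t) powr q = (K * (1 + r\<^sup>2 + 2 * r * cos t)) powr q"
      by (simp add: powr_mult)
    also have "K * (1 + r\<^sup>2 + 2 * r * cos t) = (b - a) / 2 * cos t + (b + a) / 2"
      unfolding K1[symmetric] K2[symmetric] by (simp add: algebra_simps)
    finally show "F (cis t) = of_real (((b - a) / 2 * cos t + (b + a) / 2) powr q)" .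
  qed
  also have "2 * (a + b) powr q / (\<rho> ^ N * (\<rho> - 1)) = (a + b) powr q * (\<kappa> - 1) / \<rho> ^ N"
  proof -
    have "\<rho> - 1 = 2 / (\<kappa> - 1)" using \<kappa>1 by (simp add: \<rho>_def divide_simps)
    then show ?thesis using \<kappa>1 by simp
  qed
  finally show ?thesis by (simp add: psi_def q_def \<rho>_def)
qed

section \<open>Rotation invariance of Gaussian vectors\<close>

lemma orthogonal_transformation_borel_measurable:
  fixes f :: "'a::euclidean_space \<Rightarrow> 'a"
  assumes "orthogonal_transformation f"
  shows "f \<in> borel_measurable borel"
  using orthogonal_transformation_linear[OF assms] unfolding linear_conv_bounded_linear
  by (intro borel_measurable_continuous_onI linear_continuous_on)

text \<open>The library states orthogonal invariance only for \<open>real^'n\<close> with \<open>'n\<close> well-ordered. Here it follows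
  from uniqueness of a translation-invariant measure: evaluate \<open>1\<^sub>U(x) 1\<^sub>B(x + y)\<close> under
  \<open>distr lborel borel f\<close> times \<open>lborel\<close> in both orders, with \<open>U\<close> the unit ball, which \<open>f\<close> preserves.\<close>

lemma distr_lborel_orthogonal_transformation:
  fixes f :: "'a::euclidean_space \<Rightarrow> 'a"
  assumes f: "orthogonal_transformation f"
  shows "distr lborel borel f = lborel"
proof -
  define g where "g = inv f"
  have g: "orthogonal_transformation g"
    unfolding g_def using f by (rule orthogonal_transformation_inv)
  have fg: "f (g x) = x" and gf: "g (f x) = x" for x
    using orthogonal_transformation_bij[OF f] unfolding g_def
    by (auto simp: bij_def surj_f_inv_f inv_f_f)
  note [measurable] = orthogonal_transformation_borel_measurable[OF f]
    orthogonal_transformation_borel_measurable[OF g]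
  define M where "M = distr lborel borel f"
  have [measurable_cong, simp]: "sets M = sets borel" by (simp add: M_def)
  \<comment> \<open>The inverse isometry carries \<open>M\<close> back to \<open>lborel\<close>;
    \<open>M\<close> is therefore sigma-finite, as Fubini requires.\<close>
  have "distr M borel g = lborel"
    unfolding M_def by (subst distr_distr) (auto simp: comp_def gf intro!: distr_id2)
  then interpret M: sigma_finite_measure M
    using sigma_finite_measure_distr[of M borel g] sigma_finite_lborel by simp
  interpret pair_sigma_finite M lborel ..
  \<comment> \<open>By linearity of \<open>f\<close>, translating the image by \<open>c\<close>
    amounts to translating the argument by \<open>g c\<close>, which \<open>lborel\<close> does not
    notice.\<close>
  have inv: "distr M borel ((+) c) = M" for c
  proof -
    have "distr M borel ((+) c) = distr lborel borel (\<lambda>x. f (g c + x))"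
      unfolding M_def using orthogonal_transformation_linear[OF f]
      by (subst distr_distr) (auto simp: comp_def linear_add fg)
    also have "\<dots> = distr (distr lborel borel ((+) (g c))) borel f"
      by (subst distr_distr) (auto simp: comp_def)
    finally show ?thesis by (simp add: lborel_distr_plus M_def)
  qed
  define U :: "'a set" where "U = ball 0 1"
  have [measurable]: "U \<in> sets borel" by (simp add: U_def)
  have "f -` U = U"
    using orthogonal_transformation_norm[OF f] by (auto simp: U_def dist_norm)
  then have MU: "emeasure M U = emeasure lborel U"
    unfolding M_def by (subst emeasure_distr) auto
  have U: "emeasure lborel U = ennreal (unit_ball_vol (DIM('a)))"
    unfolding U_def by (subst emeasure_ball) auto
  have "emeasure M B = emeasure lborel B" if [measurable]: "B \<in> sets borel" for B
  proof -
    have "emeasure M U * emeasure lborel B = (\<integral>\<^sup>+x. indicator U x * emeasure lborel B \<partial>M)"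
      by (simp add: nn_integral_multc)
    also have "\<dots> = (\<integral>\<^sup>+x. \<integral>\<^sup>+y. indicator U x * indicator B (x + y) \<partial>lborel \<partial>M)"
    proof (rule nn_integral_cong)
      fix x
      have "emeasure lborel B = (\<integral>\<^sup>+y. indicator B y \<partial>distr lborel borel ((+) x))"
        by (simp add: lborel_distr_plus)
      also have "\<dots> = (\<integral>\<^sup>+y. indicator B (x + y) \<partial>lborel)"
        by (subst nn_integral_distr) auto
      finally show "indicator U x * emeasure lborel B = (\<integral>\<^sup>+y. indicator U x * indicator B (x + y) \<partial>lborel)"
        by (simp add: nn_integral_cmult)
    qed
    also have "\<dots> = (\<integral>\<^sup>+y. \<integral>\<^sup>+x. indicator U x * indicator B (x + y) \<partial>M \<partial>lborel)"
      by (rule Fubini'[symmetric]) measurable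
    also have "\<dots> = (\<integral>\<^sup>+y. \<integral>\<^sup>+x. indicator U (x - y) * indicator B x \<partial>M \<partial>lborel)"
    proof (rule nn_integral_cong)
      fix y
      have "(\<integral>\<^sup>+x. indicator U (x - y) * indicator B x \<partial>M) =
        (\<integral>\<^sup>+x. indicator U (x - y) * indicator B x \<partial>distr M borel ((+) y))"
        by (simp only: inv)
      also have "\<dots> = (\<integral>\<^sup>+x. indicator U (y + x - y) * indicator B (y + x) \<partial>M)"
        by (subst nn_integral_distr) auto
      finally show "(\<integral>\<^sup>+x. indicator U x * indicator B (x + y) \<partial>M) =
        (\<integral>\<^sup>+x. indicator U (x - y) * indicator B x \<partial>M)"
        by (simp add: add.commute)
    qed
    also have "\<dots> = (\<integral>\<^sup>+x. \<integral>\<^sup>+y. indicator U (x - y) * indicator B x \<partial>lborel \<partial>M)"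
      by (rule Fubini') measurable
    also have "\<dots> = (\<integral>\<^sup>+x. emeasure lborel U * indicator B x \<partial>M)"
    proof (rule nn_integral_cong)
      fix x
      have "(\<integral>\<^sup>+y. indicator U (x - y) \<partial>lborel) = (\<integral>\<^sup>+y. indicator U (x - y) \<partial>distr lborel borel ((+) x))"
        by (simp add: lborel_distr_plus)
      also have "\<dots> = (\<integral>\<^sup>+y. indicator U (x - (x + y)) \<partial>lborel)"
        by (subst nn_integral_distr) auto
      also have "\<dots> = (\<integral>\<^sup>+y. indicator U y \<partial>lborel)"
        by (intro nn_integral_cong) (auto simp: U_def dist_norm split: split_indicator)
      finally show "(\<integral>\<^sup>+y. indicator U (x - y) * indicator B x \<partial>lborel) = emeasure lborel U * indicator B x"
        by (simp add: nn_integral_multc)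
    qed
    also have "\<dots> = emeasure lborel U * emeasure M B"
      by (simp add: nn_integral_cmult)
    finally have "emeasure lborel U * emeasure lborel B = emeasure lborel U * emeasure M B"
      by (simp add: MU)
    \<comment> \<open>The unit ball has positive finite measure, so it can be cancelled.\<close>
    moreover have "emeasure lborel U \<noteq> 0" "emeasure lborel U \<noteq> \<top>"
      by (simp_all add: U ennreal_eq_0_iff not_le)
    ultimately show ?thesis
      by (metis ennreal_mult_cancel_left)
  qed
  then show ?thesis
    unfolding M_def[symmetric] by (intro measure_eqI) auto
qed

section \<open>The density of a Gaussian vector and its behaviour under orthogonal maps\<close>

lemma vec_lambda_measurable_PiM:
  "(\<lambda>f. \<chi> i. f i) \<in> (\<Pi>\<^sub>M i\<in>(UNIV::'n::finite set). (borel :: real measure)) \<rightarrow>\<^sub>M borel"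
  by (subst borel_measurable_euclidean_space) (auto simp: Basis_vec_def inner_axis)

lemma vec_nth_borel_measurable [measurable]: "(\<lambda>x::real^'n. x $ i) \<in> borel_measurable borel"
  by (intro borel_measurable_continuous_onI continuous_intros)

text \<open>Both measures give a box the product of its side lengths, which characterises Lebesgue
  measure. This connects the product measures that express independence with densities on
  vectors.\<close>

lemma lborel_vec_eq_distr_PiM:
  "(lborel :: (real^'n) measure) = distr (\<Pi>\<^sub>M i\<in>(UNIV::'n set). lborel) borel (\<lambda>f. \<chi> i. f i)"
proof (rule lborel_eqI)
  interpret product_sigma_finite "\<lambda>_::'n. lborel :: real measure" ..
  fix l u :: "real^'n"
  assume lu: "\<And>b. b \<in> Basis \<Longrightarrow> l \<bullet> b \<le> u \<bullet> b"
  have [measurable]: "(\<lambda>f. \<chi> i. f i) \<in> (\<Pi>\<^sub>M i\<in>(UNIV::'n set). (lborel :: real measure)) \<rightarrow>\<^sub>M borel"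
    using vec_lambda_measurable_PiM by (simp cong: measurable_cong_sets sets_PiM_cong)
  have le: "l $ i \<le> u $ i" for i
    using lu[of "axis i 1"] by (simp add: inner_axis axis_in_Basis_iff)
  have "(\<lambda>f. \<chi> i. f i) -` box l u \<inter> space (\<Pi>\<^sub>M i\<in>(UNIV::'n set). lborel) = PiE UNIV (\<lambda>i. {l$i<..<u$i})"
    by (auto simp: mem_box_cart space_PiM PiE_iff)
  then have "emeasure (distr (\<Pi>\<^sub>M i\<in>(UNIV::'n set). lborel) borel (\<lambda>f. \<chi> i. f i)) (box l u) =
    (\<Prod>i\<in>UNIV. ennreal (u $ i - l $ i))"
    by (subst emeasure_distr) (auto simp: emeasure_PiM le)
  also have "\<dots> = ennreal (\<Prod>i\<in>UNIV. u $ i - l $ i)"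
    using le by (intro prod_ennreal) auto
  also have "(\<Prod>i\<in>UNIV. u $ i - l $ i) = (\<Prod>b\<in>(\<lambda>i. axis i 1) ` UNIV. (u - l) \<bullet> b)"
    by (subst prod.reindex) (auto simp: inj_on_def axis_eq_axis inner_axis)
  also have "(\<lambda>i. axis i 1) ` UNIV = (Basis :: (real^'n) set)"
    by (auto simp: Basis_vec_def)
  finally show "emeasure (distr (\<Pi>\<^sub>M i\<in>(UNIV::'n set). lborel) borel (\<lambda>f. \<chi> i. f i)) (box l u) =
    ennreal (\<Prod>b\<in>Basis. (u - l) \<bullet> b)" .
qed simp

text \<open>On rectangles the integral of a product factors, so the product of the densities is a
  density of the product measure; the passage from functions to vectors then carries it to
  \<open>lborel\<close>.\<close>

lemma distr_PiM_density_vec: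
  fixes h :: "real \<Rightarrow> real"
  assumes [measurable]: "h \<in> borel_measurable borel" and h: "\<And>x. 0 \<le> h x"
    and prob: "prob_space (density lborel h)"
  shows "distr (\<Pi>\<^sub>M i\<in>(UNIV::'n::finite set). density lborel h) borel (\<lambda>f. \<chi> i. f i) =
    density lborel (\<lambda>x::real^'n. \<Prod>i\<in>UNIV. h (x $ i))"
proof -
  interpret D: prob_space "density lborel h" by fact
  interpret product_sigma_finite "\<lambda>_::'n. lborel :: real measure" ..
  interpret H: product_sigma_finite "\<lambda>_::'n. density lborel h" ..
  have "density (\<Pi>\<^sub>M i\<in>(UNIV::'n set). lborel) (\<lambda>f. \<Prod>i\<in>UNIV. h (f i)) = (\<Pi>\<^sub>M i\<in>(UNIV::'n set). density lborel h)"
  proof (rule H.PiM_eqI)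
    show "sets (density (\<Pi>\<^sub>M i\<in>(UNIV::'n set). lborel) (\<lambda>f. \<Prod>i\<in>UNIV. h (f i))) =
      sets (\<Pi>\<^sub>M i\<in>(UNIV::'n set). density lborel h)"
      by (simp cong: sets_PiM_cong)
    fix A :: "'n \<Rightarrow> real set" assume A: "\<And>i. i \<in> UNIV \<Longrightarrow> A i \<in> sets (density lborel h)"
    then have [measurable]: "A i \<in> sets borel" for i by simp
    have "emeasure (density (\<Pi>\<^sub>M i\<in>(UNIV::'n set). lborel) (\<lambda>f. \<Prod>i\<in>UNIV. h (f i))) (Pi\<^sub>E UNIV A) =
      (\<integral>\<^sup>+f. ennreal (\<Prod>i\<in>UNIV. h (f i)) * indicator (Pi\<^sub>E UNIV A) f \<partial>(\<Pi>\<^sub>M i\<in>(UNIV::'n set). lborel))"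
      by (subst emeasure_density) (auto intro!: sets_PiM_I_finite)
    also have "\<dots> = (\<integral>\<^sup>+f. (\<Prod>i\<in>UNIV. ennreal (h (f i)) * indicator (A i) (f i)) \<partial>(\<Pi>\<^sub>M i\<in>(UNIV::'n set). lborel))"
      by (intro nn_integral_cong)
        (auto simp: prod.distrib prod_ennreal h PiE_iff split: split_indicator)
    also have "\<dots> = (\<Prod>i\<in>UNIV. \<integral>\<^sup>+x. ennreal (h x) * indicator (A i) x \<partial>lborel)"
      by (subst product_nn_integral_prod) auto
    also have "\<dots> = (\<Prod>i\<in>UNIV. emeasure (density lborel h) (A i))"
      by (intro prod.cong refl emeasure_density[symmetric]) auto
    finally show "emeasure (density (\<Pi>\<^sub>M i\<in>(UNIV::'n set). lborel) (\<lambda>f. \<Prod>i\<in>UNIV. h (f i))) (Pi\<^sub>E UNIV A) =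
      (\<Prod>i\<in>UNIV. emeasure (density lborel h) (A i))" .
  qed auto
  moreover have "density (distr (\<Pi>\<^sub>M i\<in>(UNIV::'n set). lborel) borel (\<lambda>f. \<chi> i. f i)) (\<lambda>x::real^'n. \<Prod>i\<in>UNIV. h (x $ i)) =
    distr (density (\<Pi>\<^sub>M i\<in>(UNIV::'n set). lborel) (\<lambda>f. \<Prod>i\<in>UNIV. h ((\<chi> i. f i) $ i))) borel (\<lambda>f. \<chi> i. f i)"
    using vec_lambda_measurable_PiM by (intro density_distr) (auto cong: measurable_cong_sets sets_PiM_cong)
  ultimately show ?thesis
    by (simp add: lborel_vec_eq_distr_PiM[symmetric])
qed

lemma (in prob_space) std_gaussian_vector_measurable:
  assumes "std_gaussian_vector M X"
  shows "X \<in> borel_measurable M"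
proof -
  have "(\<lambda>\<omega>. X \<omega> $ i) \<in> borel_measurable M" for i
    using assms by (simp add: std_gaussian_vector_def distributed_def)
  then show ?thesis
    by (subst borel_measurable_euclidean_space) (auto simp: Basis_vec_def inner_axis)
qed

lemma (in prob_space) distr_std_gaussian_vector:
  fixes X :: "'a \<Rightarrow> real^'n"
  assumes X: "std_gaussian_vector M X"
  shows "distr M borel X = density lborel (\<lambda>x. \<Prod>i\<in>UNIV. std_normal_density (x $ i))"
proof -
  have ind: "indep_vars (\<lambda>_. borel) (\<lambda>i \<omega>. X \<omega> $ i) UNIV"
    and dist: "\<And>i. distributed M lborel (\<lambda>\<omega>. X \<omega> $ i) std_normal_density"
    using X by (auto simp: std_gaussian_vector_def)
  have meas [measurable]: "(\<lambda>\<omega>. X \<omega> $ i) \<in> borel_measurable M" for i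
    using dist[of i] by (simp add: distributed_def)
  have comp: "distr M borel (\<lambda>\<omega>. X \<omega> $ i) = density lborel std_normal_density" for i
    using dist[of i] by (simp add: distributed_def cong: distr_cong)
  have "distr M (\<Pi>\<^sub>M i\<in>(UNIV::'n set). borel) (\<lambda>\<omega>. \<lambda>i\<in>UNIV. X \<omega> $ i) =
      (\<Pi>\<^sub>M i\<in>(UNIV::'n set). density lborel std_normal_density)"
    using ind by (subst (asm) indep_vars_iff_distr_eq_PiM) (auto simp: comp)
  then have "distr (distr M (\<Pi>\<^sub>M i\<in>(UNIV::'n set). borel) (\<lambda>\<omega>. \<lambda>i\<in>UNIV. X \<omega> $ i)) borel (\<lambda>f. \<chi> i. f i) =
    density lborel (\<lambda>x. \<Prod>i\<in>UNIV. std_normal_density (x $ i))"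
    using distr_PiM_density_vec[of std_normal_density, where 'n='n] prob_space_normal_density[of 1 0]
    by simp
  moreover have "distr (distr M (\<Pi>\<^sub>M i\<in>(UNIV::'n set). borel) (\<lambda>\<omega>. \<lambda>i\<in>UNIV. X \<omega> $ i)) borel (\<lambda>f. \<chi> i. f i) =
    distr M borel X"
    using vec_lambda_measurable_PiM
    by (subst distr_distr) (auto simp: comp_def measurable_restrict vec_eq_iff intro!: distr_cong)
  ultimately show ?thesis by simp
qed

text \<open>Independence of the coordinates says that the joint law is the product of the marginals.
  It is thus a property of the law of the vector, as are the marginals themselves.\<close>

lemma (in prob_space) std_gaussian_vector_distr_cong:
  fixes X Y :: "'a \<Rightarrow> real^'n"
  assumes X: "std_gaussian_vector M X" and Y [measurable]: "Y \<in> borel_measurable M"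
    and eq: "distr M borel Y = distr M borel X"
  shows "std_gaussian_vector M Y"
proof -
  note [measurable] = std_gaussian_vector_measurable[OF X]
  have D: "distr M N (\<lambda>\<omega>. g (Y \<omega>)) = distr M N (\<lambda>\<omega>. g (X \<omega>))" if "g \<in> borel \<rightarrow>\<^sub>M N"
    for g and N :: "'b measure"
  proof -
    have "distr M N (\<lambda>\<omega>. g (Y \<omega>)) = distr (distr M borel Y) N g"
      using that by (subst distr_distr) (auto simp: comp_def)
    also have "\<dots> = distr M N (\<lambda>\<omega>. g (X \<omega>))"
      using that by (subst eq, subst distr_distr) (auto simp: comp_def)
    finally show ?thesis .
  qed
  have "distr M (\<Pi>\<^sub>M i\<in>(UNIV::'n set). borel) (\<lambda>\<omega>. \<lambda>i\<in>UNIV. Y \<omega> $ i) =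
      distr M (\<Pi>\<^sub>M i\<in>(UNIV::'n set). borel) (\<lambda>\<omega>. \<lambda>i\<in>UNIV. X \<omega> $ i)"
    by (rule D) (intro measurable_restrict vec_nth_borel_measurable)
  also have "\<dots> = (\<Pi>\<^sub>M i\<in>(UNIV::'n set). distr M borel (\<lambda>\<omega>. X \<omega> $ i))"
    using X by (subst indep_vars_iff_distr_eq_PiM[symmetric]) (auto simp: std_gaussian_vector_def)
  also have "\<dots> = (\<Pi>\<^sub>M i\<in>(UNIV::'n set). distr M borel (\<lambda>\<omega>. Y \<omega> $ i))"
    by (intro PiM_cong refl D[symmetric] vec_nth_borel_measurable)
  finally have "indep_vars (\<lambda>_. borel) (\<lambda>i \<omega>. Y \<omega> $ i) UNIV"
    by (subst indep_vars_iff_distr_eq_PiM) auto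
  moreover have "distributed M lborel (\<lambda>\<omega>. Y \<omega> $ i) std_normal_density" for i
    using X D[of "\<lambda>x. x $ i" lborel] by (auto simp: std_gaussian_vector_def distributed_def)
  ultimately show ?thesis by (simp add: std_gaussian_vector_def)
qed

text \<open>The joint density depends only on the norm, which \<open>Q\<close> preserves, and
  Lebesgue measure is invariant under \<open>Q\<close>.\<close>

lemma (in prob_space) std_gaussian_vector_orthogonal_matrix:
  fixes X :: "'a \<Rightarrow> real^'n"
  assumes X: "std_gaussian_vector M X" and Q: "orthogonal_matrix Q"
  shows "std_gaussian_vector M (\<lambda>\<omega>. Q *v X \<omega>)"
proof (rule std_gaussian_vector_distr_cong[OF X])
  note [measurable] = std_gaussian_vector_measurable[OF X]
  have f: "orthogonal_transformation ((*v) Q)"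
    using Q by (simp add: orthogonal_transformation_matrix)
  note [measurable] = orthogonal_transformation_borel_measurable[OF f]
  show "(\<lambda>\<omega>. Q *v X \<omega>) \<in> borel_measurable M" by measurable
  define h where "h = (\<lambda>x::real^'n. \<Prod>i\<in>UNIV. std_normal_density (x $ i))"
  have [measurable]: "h \<in> borel_measurable borel" by (simp add: h_def)
  have h_eq: "h x = (1 / sqrt (2 * pi)) ^ CARD('n) * exp (- (norm x)\<^sup>2 / 2)" for x
  proof -
    have "h x = (\<Prod>i\<in>UNIV. (1 / sqrt (2 * pi)) * exp (- (x $ i)\<^sup>2 / 2))"
      by (simp add: h_def std_normal_density_def)
    also have "\<dots> = (1 / sqrt (2 * pi)) ^ CARD('n) * exp (\<Sum>i\<in>UNIV. - (x $ i)\<^sup>2 / 2)"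
      by (simp only: prod.distrib exp_sum finite prod_constant)
    also have "(\<Sum>i\<in>UNIV. - (x $ i)\<^sup>2 / 2) = - (norm x)\<^sup>2 / 2"
      by (simp add: norm_vec_def L2_set_def sum_nonneg sum_negf sum_divide_distrib)
    finally show ?thesis .
  qed
  have h: "h (Q *v x) = h x" for x
    using orthogonal_transformation_norm[OF f] by (simp add: h_eq)
  have "distr M borel (\<lambda>\<omega>. Q *v X \<omega>) = distr (distr M borel X) borel ((*v) Q)"
    by (subst distr_distr) (auto simp: comp_def)
  also have "\<dots> = distr (density lborel (\<lambda>x. h (Q *v x))) borel ((*v) Q)"
    by (simp only: distr_std_gaussian_vector[OF X] h) (simp only: h_def)
  also have "\<dots> = density (distr lborel borel ((*v) Q)) h"
    by (rule density_distr[symmetric]) auto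
  also have "\<dots> = distr M borel X"
    by (simp add: distr_lborel_orthogonal_transformation[OF f] distr_std_gaussian_vector[OF X] h_def)
  finally show "distr M borel (\<lambda>\<omega>. Q *v X \<omega>) = distr M borel X" .
qed

section \<open>Concentration of weighted chi-square sums\<close>

text \<open>The mixed terms vanish by independence and zero means. Integrability and the mean of the
  partial sum are part of the conclusion because the induction step needs them for the next mixed
  term.\<close>

lemma (in prob_space) indep_vars_sum_square:
  fixes Z :: "'i \<Rightarrow> 'a \<Rightarrow> real"
  assumes "finite I" "indep_vars (\<lambda>_. borel) Z I"
    and "\<And>i. i \<in> I \<Longrightarrow> integrable M (\<lambda>\<omega>. (Z i \<omega>)\<^sup>2)"
    and "\<And>i. i \<in> I \<Longrightarrow> expectation (Z i) = 0"
  shows "integrable M (\<lambda>\<omega>. (\<Sum>i\<in>I. Z i \<omega>)\<^sup>2) \<and>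
    expectation (\<lambda>\<omega>. (\<Sum>i\<in>I. Z i \<omega>)\<^sup>2) = (\<Sum>i\<in>I. expectation (\<lambda>\<omega>. (Z i \<omega>)\<^sup>2)) \<and>
    integrable M (\<lambda>\<omega>. \<Sum>i\<in>I. Z i \<omega>) \<and> expectation (\<lambda>\<omega>. \<Sum>i\<in>I. Z i \<omega>) = 0"
  using assms
proof (induction I rule: finite_induct)
  case (insert i I)
  define S where "S \<omega> = (\<Sum>i\<in>I. Z i \<omega>)" for \<omega>
  have rv: "Z j \<in> borel_measurable M" if "j \<in> insert i I" for j
    using insert.prems(1) that by (auto simp: indep_vars_def)
  have int: "integrable M (Z j)" if "j \<in> insert i I" for j
    using square_integrable_imp_integrable[OF rv[OF that]] insert.prems(2)[OF that] by simp
  have IH: "integrable M (\<lambda>\<omega>. (S \<omega>)\<^sup>2)"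
      "expectation (\<lambda>\<omega>. (S \<omega>)\<^sup>2) = (\<Sum>i\<in>I. expectation (\<lambda>\<omega>. (Z i \<omega>)\<^sup>2))"
      "integrable M S" "expectation S = 0"
    using insert.IH[OF indep_vars_subset[OF insert.prems(1)]] insert.prems(2,3)
    unfolding S_def by auto
  have iv: "indep_var borel (Z i) borel S"
    unfolding S_def by (rule indep_vars_sum) (use insert in auto)
  have ZS: "integrable M (\<lambda>\<omega>. Z i \<omega> * S \<omega>)"
    using indep_var_integrable[OF iv] int IH by simp
  have EZS: "expectation (\<lambda>\<omega>. Z i \<omega> * S \<omega>) = 0"
    using indep_var_lebesgue_integral[OF iv] int IH by simp
  have eq: "(\<Sum>i\<in>insert i I. Z i \<omega>) = Z i \<omega> + S \<omega>" for \<omega>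
    using insert.hyps by (simp add: S_def)
  have sq: "(Z i \<omega> + S \<omega>)\<^sup>2 = (Z i \<omega>)\<^sup>2 + 2 * (Z i \<omega> * S \<omega>) + (S \<omega>)\<^sup>2" for \<omega>
    by (simp add: power2_sum)
  have Zi: "integrable M (\<lambda>\<omega>. (Z i \<omega>)\<^sup>2)" "integrable M (Z i)" "expectation (Z i) = 0"
    using insert.prems(2,3) int by auto
  show ?case
    unfolding eq sq using Zi ZS EZS IH insert.hyps by simp
qed simp

text \<open>The variance of \<open>\<bar>f \<omega>\<bar>\<close> is nonnegative. This is how a
  variance bound becomes a bound on the mean absolute deviation.\<close>

lemma (in prob_space) expectation_abs_le_sqrt:
  assumes [measurable]: "f \<in> borel_measurable M" and sq: "integrable M (\<lambda>\<omega>. (f \<omega> :: real)\<^sup>2)"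
  shows "expectation (\<lambda>\<omega>. \<bar>f \<omega>\<bar>) \<le> sqrt (expectation (\<lambda>\<omega>. (f \<omega>)\<^sup>2))"
proof -
  have int: "integrable M (\<lambda>\<omega>. \<bar>f \<omega>\<bar>)"
    using square_integrable_imp_integrable[of f] sq by simp
  have "0 \<le> variance (\<lambda>\<omega>. \<bar>f \<omega>\<bar>)"
    by (rule variance_positive)
  also have "\<dots> = expectation (\<lambda>\<omega>. (f \<omega>)\<^sup>2) - (expectation (\<lambda>\<omega>. \<bar>f \<omega>\<bar>))\<^sup>2"
    using int sq by (subst variance_eq) auto
  finally show ?thesis
    by (intro real_le_rsqrt) simp
qed

text \<open>Multiplying the standard normal density by \<open>exp (s * x\<^sup>2)\<close> gives, up
  to the factor \<open>\<sigma>\<close>, the centred normal density of variance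
  \<open>1 / (1 - 2 * s)\<close>.\<close>

lemma nn_integral_exp_square_std_normal:
  assumes s: "s < 1 / 2"
  shows "(\<integral>\<^sup>+x. ennreal (exp (s * x\<^sup>2)) \<partial>density lborel std_normal_density) = ennreal (1 / sqrt (1 - 2 * s))"
proof -
  define \<sigma> where "\<sigma> = 1 / sqrt (1 - 2 * s)"
  have \<sigma>: "\<sigma> > 0" using s by (simp add: \<sigma>_def)
  have \<sigma>2: "\<sigma>\<^sup>2 = 1 / (1 - 2 * s)" using s by (simp add: \<sigma>_def power_divide)
  have eq: "std_normal_density x * exp (s * x\<^sup>2) = \<sigma> * normal_density 0 \<sigma> x" for x
  proof -
    have "exp (- x\<^sup>2 / 2) * exp (s * x\<^sup>2) = exp (- x\<^sup>2 / (2 * \<sigma>\<^sup>2))"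
      unfolding exp_add[symmetric] \<sigma>2 using s by (simp add: field_simps)
    moreover have "1 / sqrt (2 * pi) = \<sigma> * (1 / sqrt (2 * pi * \<sigma>\<^sup>2))"
      using \<sigma> by (simp add: real_sqrt_mult)
    ultimately show ?thesis
      by (simp add: std_normal_density_def normal_density_def)
  qed
  have "(\<integral>\<^sup>+x. ennreal (exp (s * x\<^sup>2)) \<partial>density lborel std_normal_density) =
      (\<integral>\<^sup>+x. ennreal (\<sigma> * normal_density 0 \<sigma> x) \<partial>lborel)"
    by (subst nn_integral_density) (auto simp: eq ennreal_mult[symmetric])
  also have "\<dots> = ennreal \<sigma> * (\<integral>\<^sup>+x. ennreal (normal_density 0 \<sigma> x) \<partial>lborel)"
    using \<sigma> by (simp add: ennreal_mult nn_integral_cmult)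
  also have "(\<integral>\<^sup>+x. ennreal (normal_density 0 \<sigma> x) \<partial>lborel) = 1"
    using prob_space.emeasure_space_1[OF prob_space_normal_density[OF \<sigma>, of 0]]
    by (simp add: emeasure_density)
  finally show ?thesis by (simp add: \<sigma>_def)
qed

text \<open>The difference \<open>f\<close> of the two sides vanishes at 0, and its derivative
  \<open>2 * x * (1 - 4 * x) / (1 - 2 * x)\<close> is nonpositive to the left of 0 and nonnegative
  to the right as long as \<open>\<bar>x\<bar> \<le> 1 / 4\<close>.\<close>

lemma neg_ln_le_chi_square_mgf:
  fixes x :: real
  assumes "\<bar>x\<bar> \<le> 1 / 4"
  shows "- x - ln (1 - 2 * x) / 2 \<le> 2 * x\<^sup>2"
proof -
  define f where "f x = 2 * x\<^sup>2 + x + ln (1 - 2 * x) / 2" for x :: real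
  define f' where "f' x = 4 * x + 1 - 1 / (1 - 2 * x)" for x :: real
  have der: "(f has_real_derivative f' x) (at x)" if "\<bar>x\<bar> \<le> 1 / 4" for x
    unfolding f_def f'_def using that
    by (auto intro!: derivative_eq_intros simp: divide_simps) (simp add: algebra_simps)
  have f'_eq: "f' x = 2 * x * (1 - 4 * x) / (1 - 2 * x)" if "\<bar>x\<bar> \<le> 1 / 4" for x
    using that unfolding f'_def by (simp add: divide_simps) (simp add: algebra_simps)
  have "f 0 \<le> f x"
  proof (cases "0 \<le> x")
    case True
    then show ?thesis
      by (rule DERIV_nonneg_imp_nondecreasing)
        (use assms True in \<open>auto intro!: exI[of _ "f' _"] der simp: f'_eq\<close>)
  next
    case False
    then have "x \<le> 0" by simp
    then show ?thesis
    proof (rule DERIV_nonpos_imp_nonincreasing)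
      fix u assume "x \<le> u" "u \<le> 0"
      then have "\<bar>u\<bar> \<le> 1 / 4" using assms by auto
      moreover from this have "2 * u * (1 - 4 * u) / (1 - 2 * u) \<le> 0"
        using \<open>u \<le> 0\<close> by (intro divide_nonpos_pos mult_nonpos_nonneg[of "2 * u"]) auto
      ultimately have "\<bar>u\<bar> \<le> 1 / 4" "f' u \<le> 0"
        by (simp_all add: f'_eq)
      then show "\<exists>y. (f has_real_derivative y) (at u) \<and> y \<le> 0"
        using der by blast
    qed
  qed
  then show ?thesis by (simp add: f_def)
qed

text \<open>The left side is the moment generating function at \<open>x\<close> of the centred
  square of a standard normal variable.\<close>

lemma exp_chi_square_mgf_le:
  fixes x :: real
  assumes x: "\<bar>x\<bar> \<le> 1 / 4"
  shows "exp (- x) * (1 / sqrt (1 - 2 * x)) \<le> exp (2 * x\<^sup>2)"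
proof -
  have pos: "1 - 2 * x > 0" using x by auto
  have "1 / sqrt (1 - 2 * x) = exp (- ln (1 - 2 * x) / 2)"
    using pos by (simp add: ln_sqrt exp_minus inverse_eq_divide flip: ln_sqrt)
  then have "exp (- x) * (1 / sqrt (1 - 2 * x)) = exp (- x - ln (1 - 2 * x) / 2)"
    by (simp flip: exp_add)
  then show ?thesis
    using neg_ln_le_chi_square_mgf[OF x] by simp
qed

section \<open>Moments, moment generating functions and tails of weighted chi-square sums\<close>

context prob_space
begin

lemma std_normal_square_moments:
  assumes X: "distributed M lborel X std_normal_density"
  shows "integrable M (\<lambda>\<omega>. ((X \<omega>)\<^sup>2 - 1)\<^sup>2)"
    and "expectation (\<lambda>\<omega>. ((X \<omega>)\<^sup>2 - 1)\<^sup>2) = 2"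
    and "expectation (\<lambda>\<omega>. (X \<omega>)\<^sup>2 - 1) = 0"
proof -
  have "has_bochner_integral lborel (\<lambda>x. std_normal_density x * x ^ 2) 1"
    using std_normal_moment_even[of 1] by (simp add: fact_numeral)
  then have i2: "integrable M (\<lambda>\<omega>. (X \<omega>) ^ 2)" and e2: "expectation (\<lambda>\<omega>. (X \<omega>) ^ 2) = 1"
    using distributed_integrable[OF X, of "\<lambda>x. x ^ 2"] distributed_integral[OF X, of "\<lambda>x. x ^ 2"]
    by (auto simp: has_bochner_integral_iff)
  have "has_bochner_integral lborel (\<lambda>x. std_normal_density x * x ^ 4) 3"
    using std_normal_moment_even[of 2] by (simp add: fact_numeral)
  then have i4: "integrable M (\<lambda>\<omega>. (X \<omega>) ^ 4)" and e4: "expectation (\<lambda>\<omega>. (X \<omega>) ^ 4) = 3"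
    using distributed_integrable[OF X, of "\<lambda>x. x ^ 4"] distributed_integral[OF X, of "\<lambda>x. x ^ 4"]
    by (auto simp: has_bochner_integral_iff)
  have eq: "((X \<omega>)\<^sup>2 - 1)\<^sup>2 = (X \<omega>) ^ 4 - 2 * (X \<omega>)\<^sup>2 + 1" for \<omega>
    by (simp add: power2_diff flip: power_mult)
  show "integrable M (\<lambda>\<omega>. ((X \<omega>)\<^sup>2 - 1)\<^sup>2)"
    unfolding eq using i2 i4 by simp
  show "expectation (\<lambda>\<omega>. ((X \<omega>)\<^sup>2 - 1)\<^sup>2) = 2"
    unfolding eq using i2 i4 e2 e4 by (simp add: prob_space)
  show "expectation (\<lambda>\<omega>. (X \<omega>)\<^sup>2 - 1) = 0"
    using i2 e2 by (simp add: prob_space)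
qed

text \<open>The summands \<open>d i * ((X \<omega> $ i)\<^sup>2 - 1)\<close> are independent and
  centred with variance \<open>2 * (d i)\<^sup>2\<close>. Since the weights lie between 0 and 1 and
  sum to 1, so do their squares sum to at most 1.\<close>

lemma weighted_chi_square_moments:
  fixes X :: "'a \<Rightarrow> real^'n" and d :: "'n \<Rightarrow> real"
  assumes X: "std_gaussian_vector M X" and d: "\<And>i. 0 \<le> d i" "(\<Sum>i\<in>UNIV. d i) = 1"
  defines "V \<equiv> \<lambda>\<omega>. (\<Sum>i\<in>UNIV. d i * (X \<omega> $ i)\<^sup>2) - 1"
  shows "integrable M (\<lambda>\<omega>. (V \<omega>)\<^sup>2)" and "expectation (\<lambda>\<omega>. (V \<omega>)\<^sup>2) \<le> 2" and "expectation V = 0"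
proof -
  define Z where "Z i \<omega> = d i * ((X \<omega> $ i)\<^sup>2 - 1)" for i \<omega>
  have dist: "\<And>i. distributed M lborel (\<lambda>\<omega>. X \<omega> $ i) std_normal_density"
    and ind: "indep_vars (\<lambda>_. borel) (\<lambda>i \<omega>. X \<omega> $ i) UNIV"
    using X by (auto simp: std_gaussian_vector_def)
  have VZ: "V \<omega> = (\<Sum>i\<in>UNIV. Z i \<omega>)" for \<omega>
    by (simp add: V_def Z_def right_diff_distrib sum_subtractf d)
  have EZ: "expectation (Z i) = 0" for i
    using std_normal_square_moments(3)[OF dist, of i] by (simp add: Z_def[abs_def])
  have "indep_vars (\<lambda>_. borel) Z UNIV"
    unfolding Z_def by (rule indep_vars_compose2[OF ind]) auto
  then have *: "integrable M (\<lambda>\<omega>. (V \<omega>)\<^sup>2) \<and>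
    expectation (\<lambda>\<omega>. (V \<omega>)\<^sup>2) = (\<Sum>i\<in>UNIV. expectation (\<lambda>\<omega>. (Z i \<omega>)\<^sup>2)) \<and>
    integrable M V \<and> expectation V = 0"
    unfolding VZ by (rule indep_vars_sum_square[OF finite])
      (simp_all add: EZ, simp add: Z_def power_mult_distrib std_normal_square_moments[OF dist])
  have d1: "d i \<le> 1" for i
    using member_le_sum[of i UNIV d] d by auto
  have "(\<Sum>i\<in>UNIV. expectation (\<lambda>\<omega>. (Z i \<omega>)\<^sup>2)) = (\<Sum>i\<in>UNIV. (d i)\<^sup>2 * 2)"
    by (simp add: Z_def power_mult_distrib std_normal_square_moments[OF dist])
  also have "\<dots> \<le> (\<Sum>i\<in>UNIV. d i * 2)"
    using d d1 by (intro sum_mono mult_right_mono) (auto simp: power2_eq_square mult_left_le)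
  also have "\<dots> = 2" using d by (simp flip: sum_distrib_right)
  finally show "expectation (\<lambda>\<omega>. (V \<omega>)\<^sup>2) \<le> 2" using * by simp
  show "integrable M (\<lambda>\<omega>. (V \<omega>)\<^sup>2)" "expectation V = 0" using * by auto
qed

text \<open>Independence factors the integral over the coordinates. Each factor is at most
  \<open>exp (2 * s\<^sup>2 * d i)\<close> because \<open>(d i)\<^sup>2 \<le> d i\<close>, and the
  exponents then add up without any dependence on the dimension.\<close>

lemma weighted_chi_square_mgf:
  fixes X :: "'a \<Rightarrow> real^'n" and d :: "'n \<Rightarrow> real"
  assumes X: "std_gaussian_vector M X" and d: "\<And>i. 0 \<le> d i" "(\<Sum>i\<in>UNIV. d i) = 1"
    and s: "\<bar>s\<bar> \<le> 1 / 4"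
  shows "(\<integral>\<^sup>+\<omega>. ennreal (exp (s * ((\<Sum>i\<in>UNIV. d i * (X \<omega> $ i)\<^sup>2) - 1))) \<partial>M) \<le> ennreal (exp (2 * s\<^sup>2))"
proof -
  have dist: "\<And>i. distributed M lborel (\<lambda>\<omega>. X \<omega> $ i) std_normal_density"
    and ind: "indep_vars (\<lambda>_. borel) (\<lambda>i \<omega>. X \<omega> $ i) UNIV"
    using X by (auto simp: std_gaussian_vector_def)
  have [measurable]: "(\<lambda>\<omega>. X \<omega> $ i) \<in> borel_measurable M" for i
    using dist[of i] by (simp add: distributed_def)
  have d1: "d i \<le> 1" for i
    using member_le_sum[of i UNIV d] d by auto
  define E where "E i x = ennreal (exp (s * d i * (x\<^sup>2 - 1)))" for i x
  have [measurable]: "E i \<in> borel_measurable borel" for i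
    unfolding E_def[abs_def] by measurable
  have "ennreal (exp (s * ((\<Sum>i\<in>UNIV. d i * (X \<omega> $ i)\<^sup>2) - 1))) = (\<Prod>i\<in>UNIV. E i (X \<omega> $ i))" for \<omega>
  proof -
    have "s * ((\<Sum>i\<in>UNIV. d i * (X \<omega> $ i)\<^sup>2) - 1) = (\<Sum>i\<in>UNIV. s * d i * ((X \<omega> $ i)\<^sup>2 - 1))"
      using d(2) by (simp add: right_diff_distrib sum_subtractf mult.assoc flip: sum_distrib_left)
    then show ?thesis by (simp add: E_def exp_sum prod_ennreal)
  qed
  then have "(\<integral>\<^sup>+\<omega>. ennreal (exp (s * ((\<Sum>i\<in>UNIV. d i * (X \<omega> $ i)\<^sup>2) - 1))) \<partial>M) =
      (\<integral>\<^sup>+\<omega>. (\<Prod>i\<in>UNIV. E i (X \<omega> $ i)) \<partial>M)" by simp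
  also have "\<dots> = (\<Prod>i\<in>UNIV. \<integral>\<^sup>+\<omega>. E i (X \<omega> $ i) \<partial>M)"
    by (rule indep_vars_nn_integral) (auto intro!: indep_vars_compose2[OF ind])
  also have "\<dots> \<le> (\<Prod>i\<in>UNIV. ennreal (exp (2 * s\<^sup>2 * d i)))"
  proof (rule prod_mono_ennreal)
    fix i :: 'n
    have sd: "\<bar>s * d i\<bar> \<le> 1 / 4"
      using s d(1)[of i] d1[of i] mult_mono[of "\<bar>s\<bar>" "1/4" "d i" 1] by (simp add: abs_mult)
    have "(\<integral>\<^sup>+\<omega>. E i (X \<omega> $ i) \<partial>M) = (\<integral>\<^sup>+x. E i x \<partial>distr M lborel (\<lambda>\<omega>. X \<omega> $ i))"
      by (subst nn_integral_distr) auto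
    also have "\<dots> = (\<integral>\<^sup>+x. ennreal (exp (- (s * d i))) * ennreal (exp (s * d i * x\<^sup>2)) \<partial>density lborel std_normal_density)"
      using dist[of i] unfolding distributed_def
      by (auto simp: E_def right_diff_distrib exp_diff exp_minus field_simps simp flip: ennreal_mult intro!: nn_integral_cong)
    also have "\<dots> = ennreal (exp (- (s * d i)) * (1 / sqrt (1 - 2 * (s * d i))))"
      using sd by (subst nn_integral_cmult) (auto simp: nn_integral_exp_square_std_normal simp flip: ennreal_mult)
    also have "\<dots> \<le> ennreal (exp (2 * (s * d i)\<^sup>2))"
      by (intro ennreal_leI exp_chi_square_mgf_le sd)
    also have "\<dots> \<le> ennreal (exp (2 * s\<^sup>2 * d i))"
    proof -
      have "(d i)\<^sup>2 \<le> d i"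
        using d(1)[of i] d1[of i] by (simp add: power2_eq_square mult_left_le)
      then have "s\<^sup>2 * (d i)\<^sup>2 \<le> s\<^sup>2 * d i"
        by (intro mult_left_mono) auto
      then show ?thesis
        by (intro ennreal_leI) (simp add: power_mult_distrib)
    qed
    finally show "(\<integral>\<^sup>+\<omega>. E i (X \<omega> $ i) \<partial>M) \<le> ennreal (exp (2 * s\<^sup>2 * d i))" .
  qed
  also have "\<dots> = ennreal (exp (2 * s\<^sup>2))"
    using d(2) by (simp add: prod_ennreal flip: exp_sum sum_distrib_left)
  finally show ?thesis .
qed

text \<open>The exponent per summand is \<open>2 * s\<^sup>2 - s * \<eta>\<close>. Its minimum is
  \<open>- (\<eta>\<^sup>2 / 8)\<close>, attained at \<open>s = \<eta> / 4\<close>, and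
  \<open>\<eta> \<le> 1\<close> keeps this \<open>s\<close> in the range of \<open>mgf\<close>. The
  lower tail uses \<open>- s\<close>.\<close>

lemma chernoff_sum_tail:
  fixes V :: "'i \<Rightarrow> 'a \<Rightarrow> real" and \<eta> :: real
  assumes fin: "finite J" and ind: "indep_vars (\<lambda>_. borel) V J"
    and mgf: "\<And>j s. j \<in> J \<Longrightarrow> \<bar>s\<bar> \<le> 1 / 4 \<Longrightarrow> (\<integral>\<^sup>+\<omega>. ennreal (exp (s * V j \<omega>)) \<partial>M) \<le> ennreal (exp (2 * s\<^sup>2))"
    and \<eta>: "0 < \<eta>" "\<eta> \<le> 1"
  shows "prob {\<omega>\<in>space M. card J * \<eta> \<le> (\<Sum>j\<in>J. V j \<omega>)} \<le> exp (- (card J * \<eta>\<^sup>2 / 8))"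
    and "prob {\<omega>\<in>space M. (\<Sum>j\<in>J. V j \<omega>) \<le> - (card J * \<eta>)} \<le> exp (- (card J * \<eta>\<^sup>2 / 8))"
proof -
  have [measurable]: "V j \<in> borel_measurable M" if "j \<in> J" for j
    using ind that by (auto simp: indep_vars_def)
  define s where "s = \<eta> / 4"
  have s: "0 < s" "s \<le> 1 / 4" using \<eta> by (auto simp: s_def)
  have prod: "(\<integral>\<^sup>+\<omega>. ennreal (exp (c * (\<Sum>j\<in>J. V j \<omega>))) \<partial>M) \<le> ennreal (exp (card J * (2 * s\<^sup>2)))"
    if c: "\<bar>c\<bar> = s" for c
  proof -
    have "(\<integral>\<^sup>+\<omega>. ennreal (exp (c * (\<Sum>j\<in>J. V j \<omega>))) \<partial>M) = (\<integral>\<^sup>+\<omega>. (\<Prod>j\<in>J. ennreal (exp (c * V j \<omega>))) \<partial>M)"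
      using fin by (simp add: sum_distrib_left exp_sum prod_ennreal)
    also have "\<dots> = (\<Prod>j\<in>J. \<integral>\<^sup>+\<omega>. ennreal (exp (c * V j \<omega>)) \<partial>M)"
      by (rule indep_vars_nn_integral) (auto intro!: fin indep_vars_compose2[OF ind])
    also have "\<dots> \<le> (\<Prod>j\<in>J. ennreal (exp (2 * s\<^sup>2)))"
    proof (rule prod_mono_ennreal)
      fix j assume "j \<in> J"
      from mgf[OF this, of c] show "(\<integral>\<^sup>+\<omega>. ennreal (exp (c * V j \<omega>)) \<partial>M) \<le> ennreal (exp (2 * s\<^sup>2))"
        using c s power2_abs[of c] by simp
    qed
    also have "\<dots> = ennreal (exp (card J * (2 * s\<^sup>2)))"
      by (simp add: ennreal_power exp_of_nat_mult)
    finally show ?thesis .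
  qed
  have bound: "ennreal (exp (- s * (card J * \<eta>))) * ennreal (exp (card J * (2 * s\<^sup>2))) =
      ennreal (exp (- (card J * \<eta>\<^sup>2 / 8)))"
    by (simp add: s_def power2_eq_square field_simps flip: ennreal_mult exp_add)
  have "emeasure M {\<omega>\<in>space M. card J * \<eta> \<le> (\<Sum>j\<in>J. V j \<omega>)} \<le>
      ennreal (exp (- s * (card J * \<eta>))) * (\<integral>\<^sup>+\<omega>. ennreal (exp (s * (\<Sum>j\<in>J. V j \<omega>))) * indicator (space M) \<omega> \<partial>M)"
    using s by (intro Chernoff_ineq_nn_integral_ge) auto
  also have "(\<integral>\<^sup>+\<omega>. ennreal (exp (s * (\<Sum>j\<in>J. V j \<omega>))) * indicator (space M) \<omega> \<partial>M) =
      (\<integral>\<^sup>+\<omega>. ennreal (exp (s * (\<Sum>j\<in>J. V j \<omega>))) \<partial>M)"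
    by (intro nn_integral_cong) auto
  also have "ennreal (exp (- s * (card J * \<eta>))) * \<dots> \<le> ennreal (exp (- (card J * \<eta>\<^sup>2 / 8)))"
    unfolding bound[symmetric] using prod[of s] s by (intro mult_left_mono) auto
  finally show "prob {\<omega>\<in>space M. card J * \<eta> \<le> (\<Sum>j\<in>J. V j \<omega>)} \<le> exp (- (card J * \<eta>\<^sup>2 / 8))"
    by (simp add: emeasure_eq_measure)
  have "emeasure M {\<omega>\<in>space M. (\<Sum>j\<in>J. V j \<omega>) \<le> - (card J * \<eta>)} \<le>
      ennreal (exp (s * - (card J * \<eta>))) * (\<integral>\<^sup>+\<omega>. ennreal (exp (- s * (\<Sum>j\<in>J. V j \<omega>))) * indicator (space M) \<omega> \<partial>M)"
    using s by (intro Chernoff_ineq_nn_integral_le) auto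
  also have "(\<integral>\<^sup>+\<omega>. ennreal (exp (- s * (\<Sum>j\<in>J. V j \<omega>))) * indicator (space M) \<omega> \<partial>M) =
      (\<integral>\<^sup>+\<omega>. ennreal (exp (- s * (\<Sum>j\<in>J. V j \<omega>))) \<partial>M)"
    by (intro nn_integral_cong) auto
  also have "ennreal (exp (s * - (card J * \<eta>))) * \<dots> \<le> ennreal (exp (- (card J * \<eta>\<^sup>2 / 8)))"
    unfolding bound[symmetric] using prod[of "- s"] s by (simp add: mult_left_mono)
  finally show "prob {\<omega>\<in>space M. (\<Sum>j\<in>J. V j \<omega>) \<le> - (card J * \<eta>)} \<le> exp (- (card J * \<eta>\<^sup>2 / 8))"
    by (simp add: emeasure_eq_measure)
qed

end

section \<open>The Schatten norm estimator\<close>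

text \<open>For exponents in the unit interval, \<open>u powr r\<close> lies between
  \<open>u\<close> and 1. At \<open>u = 0\<close> the value of \<open>0 powr r\<close> is 0, also
  for \<open>r = 0\<close>.\<close>

lemma abs_powr_minus_one_le:
  fixes u r :: real
  assumes "0 \<le> u" "0 \<le> r" "r \<le> 1"
  shows "\<bar>u powr r - 1\<bar> \<le> \<bar>u - 1\<bar>"
proof -
  consider "u = 0" | "0 < u" "u \<le> 1" | "1 \<le> u" using assms by linarith
  then show ?thesis
  proof cases
    case 2
    have "u powr 1 \<le> u powr r" "u powr r \<le> 1"
      using 2 assms powr_mono'[of r 1 u] powr_le1[of r u] by auto
    then show ?thesis using 2 by simp
  next
    case 3
    have "u powr r \<le> u powr 1" "1 \<le> u powr r"
      using 3 assms powr_mono[of r 1 u] ge_one_powr_ge_zero[of u r] by auto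
    then show ?thesis using 3 by simp
  qed simp
qed

lemma abs_powr_diff_le:
  fixes x t r :: real
  assumes "0 \<le> x" "0 < t" "0 \<le> r" "r \<le> 1"
  shows "\<bar>x powr r - t powr r\<bar> \<le> t powr r * \<bar>x / t - 1\<bar>"
proof -
  have "x powr r = t powr r * (x / t) powr r"
    using assms by (simp flip: powr_mult)
  then have "\<bar>x powr r - t powr r\<bar> = \<bar>t powr r * ((x / t) powr r - 1)\<bar>"
    by (simp add: right_diff_distrib)
  also have "\<dots> = t powr r * \<bar>(x / t) powr r - 1\<bar>"
    by (simp add: abs_mult)
  also have "\<dots> \<le> t powr r * \<bar>x / t - 1\<bar>"
    using assms by (intro mult_left_mono abs_powr_minus_one_le) auto
  finally show ?thesis .
qed

text \<open>The condition on \<open>N\<close> is \<open>L \<le> \<rho> ^ N\<close> in logarithmic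
  form. It makes the error of \<open>psi\<close> at most \<open>\<epsilon> / 8\<close> relative to
  \<open>X\<close>, since \<open>a powr (p / 2) \<le> X\<close>; squaring costs a factor of at most
  4.\<close>

lemma psi_square_relative_error:
  fixes a b p \<kappa> \<epsilon> x :: real
  assumes a: "0 < a" and ab: "a < b" and p: "0 \<le> p" and \<kappa>: "\<kappa> = sqrt (b / a)"
    and \<epsilon>: "0 < \<epsilon>" "\<epsilon> \<le> 1"
    and N: "real N \<ge> ln (4 / \<epsilon> * (\<kappa>\<^sup>2 + 1) powr (p / 2) * (\<kappa> - 1) * (\<kappa> powr p + sqrt (\<epsilon> / 2 + \<kappa> powr (2 * p))))
        / ln ((\<kappa> + 1) / (\<kappa> - 1))"
    and x: "x \<in> {a..b}"
  shows "\<bar>(poly (psi p a b N) x)\<^sup>2 - x powr p\<bar> \<le> \<epsilon> / 2 * x powr p"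
proof -
  define \<rho> where "\<rho> = (\<kappa> + 1) / (\<kappa> - 1)"
  define D where "D = \<kappa> powr p + sqrt (\<epsilon> / 2 + \<kappa> powr (2 * p))"
  define L where "L = 4 / \<epsilon> * (\<kappa>\<^sup>2 + 1) powr (p / 2) * (\<kappa> - 1) * D"
  define X where "X = x powr (p / 2)"
  have \<kappa>1: "\<kappa> > 1" using a ab by (simp add: \<kappa>)
  have b: "b = a * \<kappa>\<^sup>2" using a ab by (simp add: \<kappa>)
  have \<rho>1: "\<rho> > 1" using \<kappa>1 by (simp add: \<rho>_def divide_simps)
  have D: "D \<ge> 2"
  proof -
    have "1 \<le> \<kappa> powr p" "1 \<le> \<kappa> powr (2 * p)"
      using \<kappa>1 p by (auto intro!: ge_one_powr_ge_zero)
    moreover from this have "1 \<le> sqrt (\<epsilon> / 2 + \<kappa> powr (2 * p))"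
      using \<epsilon> by simp
    ultimately show ?thesis unfolding D_def by linarith
  qed
  have L: "L > 0"
  proof -
    have "\<kappa>\<^sup>2 + 1 > 0" by (simp add: add_nonneg_pos)
    then show ?thesis
      unfolding L_def using \<epsilon> \<kappa>1 D by (intro mult_pos_pos divide_pos_pos) auto
  qed
  have "ln L / ln \<rho> \<le> real N"
    using N by (simp add: L_def D_def \<rho>_def)
  then have "ln L \<le> ln (\<rho> ^ N)"
    using \<rho>1 by (simp add: divide_le_eq ln_realpow)
  then have LN: "L \<le> \<rho> ^ N"
    using L \<rho>1 by simp
  have ab_eq: "(a + b) powr (p / 2) = a powr (p / 2) * (\<kappa>\<^sup>2 + 1) powr (p / 2)"
    using a by (simp add: b algebra_simps flip: powr_mult)
  have aX: "a powr (p / 2) \<le> X"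
    unfolding X_def using a x p by (intro powr_mono2) auto
  have "\<bar>poly (psi p a b N) x - X\<bar> \<le> (a + b) powr (p / 2) * (\<kappa> - 1) / \<rho> ^ N"
    unfolding X_def \<rho>_def by (rule psi_error[OF a ab p \<kappa> x])
  also have "\<dots> \<le> (a + b) powr (p / 2) * (\<kappa> - 1) / L"
    using LN L \<kappa>1 by (intro divide_left_mono mult_nonneg_nonneg mult_pos_pos) auto
  \<comment> \<open>The factors \<open>(\<kappa>\<^sup>2 + 1) powr (p / 2)\<close> and
    \<open>\<kappa> - 1\<close> of \<open>L\<close> cancel against the error bound, by
    \<open>ab_eq\<close>.\<close>
  also have "\<dots> = a powr (p / 2) * (\<epsilon> / 4) / D"
    using \<kappa>1 D \<epsilon> add_nonneg_pos[of "\<kappa>\<^sup>2" 1] by (simp add: L_def ab_eq divide_simps)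
  also have "\<dots> \<le> a powr (p / 2) * (\<epsilon> / 4) / 2"
    using D \<epsilon> by (intro divide_left_mono) auto
  also have "\<dots> \<le> X * (\<epsilon> / 8)"
    using aX \<epsilon> by (simp add: mult_right_mono)
  finally have e: "\<bar>poly (psi p a b N) x - X\<bar> \<le> X * (\<epsilon> / 8)" .
  have X0: "X \<ge> 0" by (simp add: X_def)
  have X2: "x powr p = X\<^sup>2"
    by (simp add: X_def power2_eq_square flip: powr_add)
  have "\<bar>(poly (psi p a b N) x)\<^sup>2 - X\<^sup>2\<bar> = \<bar>poly (psi p a b N) x - X\<bar> * \<bar>poly (psi p a b N) x + X\<bar>"
    by (simp add: power2_eq_square square_diff_square_factored abs_mult mult.commute)
  \<comment> \<open>The sum lies within \<open>X * (\<epsilon> / 8)\<close> of \<open>2 * X\<close>;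
    the rounder factor 4 turns \<open>\<epsilon> / 8\<close> into
    \<open>\<epsilon> / 2\<close>.\<close>
  also have "\<dots> \<le> (X * (\<epsilon> / 8)) * (X * 4)"
  proof (intro mult_mono e)
    have "X * (\<epsilon> / 8) \<le> X * 1" using X0 \<epsilon> by (intro mult_left_mono) auto
    then show "\<bar>poly (psi p a b N) x + X\<bar> \<le> X * 4" using e X0 by linarith
  qed (use X0 \<epsilon> in auto)
  also have "\<dots> = \<epsilon> / 2 * X\<^sup>2"
    by (simp add: power2_eq_square)
  finally show ?thesis by (simp add: X2)
qed

section \<open>Concentration of the normalised mean of quadratic forms\<close>

context prob_space
begin

text \<open>Dividing by the sum of the \<open>d i\<close> gives weights \<open>c\<close> of total 1.
  Then \<open>X \<omega> - 1\<close> is the mean of \<open>K\<close> independent centred variables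
  \<open>V j\<close> with variance at most 2, to which the second-moment and Chernoff bounds
  apply.\<close>

lemma gaussian_quadratic_mean_concentration:
  fixes g :: "nat \<Rightarrow> 'a \<Rightarrow> real^'n" and d :: "'n \<Rightarrow> real"
  assumes g: "indep_std_gaussian_vectors M K g" and K: "1 \<le> K"
    and d: "\<And>i. 0 \<le> d i" and T: "0 < (\<Sum>i\<in>UNIV. d i)"
  defines "X \<equiv> \<lambda>\<omega>. (1 / real K * (\<Sum>j=1..K. \<Sum>i\<in>UNIV. d i * (g j \<omega> $ i)\<^sup>2)) / (\<Sum>i\<in>UNIV. d i)"
  shows "integrable M X" and "expectation (\<lambda>\<omega>. \<bar>X \<omega> - 1\<bar>) \<le> sqrt (2 / real K)"
    and "0 < \<eta> \<Longrightarrow> \<eta> \<le> 1 \<Longrightarrow>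
      prob {\<omega>\<in>space M. \<bar>X \<omega> - 1\<bar> \<le> \<eta>} \<ge> 1 - 2 * exp (- (real K * \<eta>\<^sup>2 / 8))"
proof -
  define c where "c i = d i / (\<Sum>i\<in>UNIV. d i)" for i
  define V where "V j \<omega> = (\<Sum>i\<in>UNIV. c i * (g j \<omega> $ i)\<^sup>2) - 1" for j \<omega>
  have c: "0 \<le> c i" "(\<Sum>i\<in>UNIV. c i) = 1" for i
    using d T by (auto simp: c_def simp flip: sum_divide_distrib)
  have gj: "std_gaussian_vector M (g j)" if "j \<in> {1..K}" for j
    using g that by (simp add: indep_std_gaussian_vectors_def)
  have ind: "indep_vars (\<lambda>_. borel) V {1..K}"
    unfolding V_def[abs_def]
    by (rule indep_vars_compose2[where M' = "\<lambda>_. borel" and X = g and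
          Y = "\<lambda>_ x. (\<Sum>i\<in>UNIV. c i * (x $ i)\<^sup>2) - 1"])
      (use g in \<open>simp_all add: indep_std_gaussian_vectors_def\<close>)
  have V: "integrable M (\<lambda>\<omega>. (V j \<omega>)\<^sup>2)" "expectation (\<lambda>\<omega>. (V j \<omega>)\<^sup>2) \<le> 2" "expectation (V j) = 0"
    if "j \<in> {1..K}" for j
    using weighted_chi_square_moments[OF gj[OF that] c] by (simp_all only: V_def[abs_def])
  have X_eq: "X \<omega> - 1 = (\<Sum>j=1..K. V j \<omega>) / real K" for \<omega>
  proof -
    have "(\<Sum>j=1..K. V j \<omega>) = (\<Sum>j=1..K. \<Sum>i\<in>UNIV. d i * (g j \<omega> $ i)\<^sup>2) / (\<Sum>i\<in>UNIV. d i) - real K"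
      by (simp add: V_def c_def sum_subtractf sum_divide_distrib)
    then show ?thesis using K by (simp add: X_def diff_divide_distrib)
  qed
  have "integrable M (\<lambda>\<omega>. (\<Sum>j=1..K. V j \<omega>)\<^sup>2) \<and>
    expectation (\<lambda>\<omega>. (\<Sum>j=1..K. V j \<omega>)\<^sup>2) = (\<Sum>j=1..K. expectation (\<lambda>\<omega>. (V j \<omega>)\<^sup>2)) \<and>
    integrable M (\<lambda>\<omega>. \<Sum>j=1..K. V j \<omega>) \<and> expectation (\<lambda>\<omega>. \<Sum>j=1..K. V j \<omega>) = 0"
    by (rule indep_vars_sum_square[OF _ ind]) (simp_all only: V finite_atLeastAtMost)
  then have sq: "integrable M (\<lambda>\<omega>. (\<Sum>j=1..K. V j \<omega>)\<^sup>2)"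
    and esq: "expectation (\<lambda>\<omega>. (\<Sum>j=1..K. V j \<omega>)\<^sup>2) = (\<Sum>j=1..K. expectation (\<lambda>\<omega>. (V j \<omega>)\<^sup>2))"
    and int: "integrable M (\<lambda>\<omega>. \<Sum>j=1..K. V j \<omega>)"
    by auto
  have "integrable M (\<lambda>\<omega>. (\<Sum>j=1..K. V j \<omega>) / real K + 1)"
    using int by simp
  moreover have "X = (\<lambda>\<omega>. (\<Sum>j=1..K. V j \<omega>) / real K + 1)"
    by (simp only: X_eq[symmetric] diff_add_cancel)
  ultimately show "integrable M X" by (simp only:)
  have "expectation (\<lambda>\<omega>. (\<Sum>j=1..K. V j \<omega>)\<^sup>2) \<le> (\<Sum>j=1..K. 2)"
    unfolding esq by (intro sum_mono V(2))
  then have e2: "expectation (\<lambda>\<omega>. (\<Sum>j=1..K. V j \<omega>)\<^sup>2) \<le> 2 * real K" by simp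
  have "expectation (\<lambda>\<omega>. \<bar>X \<omega> - 1\<bar>) = expectation (\<lambda>\<omega>. \<bar>\<Sum>j=1..K. V j \<omega>\<bar>) / real K"
    by (simp add: X_eq)
  also have "\<dots> \<le> sqrt (expectation (\<lambda>\<omega>. (\<Sum>j=1..K. V j \<omega>)\<^sup>2)) / real K"
    using int sq by (intro divide_right_mono expectation_abs_le_sqrt) auto
  also have "\<dots> \<le> sqrt (2 * real K) / real K"
    using e2 by (intro divide_right_mono) auto
  also have "\<dots> = sqrt (2 / real K)"
    using K by (simp add: real_sqrt_mult real_sqrt_divide real_div_sqrt field_simps)
  finally show "expectation (\<lambda>\<omega>. \<bar>X \<omega> - 1\<bar>) \<le> sqrt (2 / real K)" .
  assume \<eta>: "0 < \<eta>" "\<eta> \<le> 1"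
  define A1 where "A1 = {\<omega>\<in>space M. real K * \<eta> \<le> (\<Sum>j=1..K. V j \<omega>)}"
  define A2 where "A2 = {\<omega>\<in>space M. (\<Sum>j=1..K. V j \<omega>) \<le> - (real K * \<eta>)}"
  have [measurable]: "(\<lambda>\<omega>. \<Sum>j=1..K. V j \<omega>) \<in> borel_measurable M"
    using int by auto
  have [measurable]: "A1 \<in> events" "A2 \<in> events"
    unfolding A1_def A2_def by measurable
  have mgf: "(\<integral>\<^sup>+\<omega>. ennreal (exp (s * V j \<omega>)) \<partial>M) \<le> ennreal (exp (2 * s\<^sup>2))"
    if "j \<in> {1..K}" "\<bar>s\<bar> \<le> 1 / 4" for j s
    unfolding V_def using weighted_chi_square_mgf[OF gj[OF that(1)] c that(2)] .
  have "prob A1 \<le> exp (- (real K * \<eta>\<^sup>2 / 8))" "prob A2 \<le> exp (- (real K * \<eta>\<^sup>2 / 8))"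
    unfolding A1_def A2_def
    using chernoff_sum_tail[OF finite_atLeastAtMost ind mgf \<eta>] by simp_all
  moreover have "prob (A1 \<union> A2) \<le> prob A1 + prob A2"
    by (rule measure_subadditive) auto
  moreover have "prob (space M - (A1 \<union> A2)) = 1 - prob (A1 \<union> A2)"
    by (rule prob_compl) auto
  moreover have "prob (space M - (A1 \<union> A2)) \<le> prob {\<omega>\<in>space M. \<bar>X \<omega> - 1\<bar> \<le> \<eta>}"
  proof (rule finite_measure_mono)
    show "space M - (A1 \<union> A2) \<subseteq> {\<omega>\<in>space M. \<bar>X \<omega> - 1\<bar> \<le> \<eta>}"
      using K unfolding A1_def A2_def X_eq
      by (auto simp: abs_le_iff divide_le_eq mult.commute minus_divide_left simp del: minus_divide_left[symmetric])
    show "{\<omega>\<in>space M. \<bar>X \<omega> - 1\<bar> \<le> \<eta>} \<in> events"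
      unfolding X_eq by measurable
  qed
  ultimately show "prob {\<omega>\<in>space M. \<bar>X \<omega> - 1\<bar> \<le> \<eta>} \<ge> 1 - 2 * exp (- (real K * \<eta>\<^sup>2 / 8))"
    by linarith
qed

lemma indep_std_gaussian_vectors_orthogonal_matrix:
  fixes w :: "nat \<Rightarrow> 'a \<Rightarrow> real^'n"
  assumes w: "indep_std_gaussian_vectors M K w" and Q: "orthogonal_matrix Q"
  shows "indep_std_gaussian_vectors M K (\<lambda>j \<omega>. Q *v w j \<omega>)"
proof -
  have "orthogonal_transformation ((*v) Q)"
    using Q by (simp add: orthogonal_transformation_matrix)
  then have meas: "(*v) Q \<in> borel_measurable borel"
    by (rule orthogonal_transformation_borel_measurable)
  have "indep_vars (\<lambda>_. borel) (\<lambda>j \<omega>. Q *v w j \<omega>) {1..K}"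
    by (rule indep_vars_compose2[where M' = "\<lambda>_. borel" and X = w and Y = "\<lambda>_. (*v) Q"])
      (use w meas in \<open>simp_all add: indep_std_gaussian_vectors_def\<close>)
  then show ?thesis
    using w Q by (auto simp: indep_std_gaussian_vectors_def std_gaussian_vector_orthogonal_matrix)
qed

end

theorem theorem2:
  fixes P :: "'a measure"
    and A :: "real^'n^'n"
    and w :: "nat \<Rightarrow> 'a \<Rightarrow> real^'n"
    and a b \<epsilon> p q \<kappa> :: real
    and M N :: nat
  assumes "prob_space P"
    and "0 < a" and "a < b"
    and "sym_pos_def A"
    and "\<forall>\<mu>\<in>#eigenvalues A. a \<le> \<mu> \<and> \<mu> \<le> b"
    and "0 < \<epsilon>" and "\<epsilon> \<le> 1"
    and "1 \<le> p" and "q = p / 2" and "\<kappa> = sqrt (b / a)"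
    and "real N \<ge>
      ln (4 / \<epsilon> * (\<kappa>\<^sup>2 + 1) powr q * (\<kappa> - 1) * (\<kappa> powr p + sqrt (\<epsilon> / 2 + \<kappa> powr (2 * p))))
        / ln ((\<kappa> + 1) / (\<kappa> - 1))"
    and "indep_std_gaussian_vectors P M w"
  shows "(1 \<le> M \<longrightarrow>
        integrable P (Y_est p a b A w M N) \<and>
        \<bar>prob_space.expectation P (Y_est p a b A w M N) - schatten_norm p A\<bar>
          \<le> (1 + \<epsilon> / 2) * schatten_norm p A * (2 / real M) powr (1 / 2)
            + \<epsilon> / 2 * schatten_norm p A)
    \<and> (\<forall>\<delta>. 0 < \<delta> \<and> \<delta> < 1 \<and> real M \<ge> 72 / \<epsilon>\<^sup>2 * ln (2 / \<delta>) \<longrightarrow>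
        eps_delta_estimator P \<epsilon> \<delta> (Y_est p a b A w M N) (schatten_norm p A))"
proof -
  interpret prob_space P by fact
  obtain Q d where Q: "orthogonal_matrix Q" and A: "A = Q ** diag_matrix d ** transpose Q"
    using symmetric_matrix_diagonalization assms(4) by (auto simp: sym_pos_def_def)
  have eig: "eigenvalues A = image_mset d (mset_set UNIV)"
    unfolding A by (rule eigenvalues_orthogonal_diag_conj[OF Q])
  have d: "d i \<in> {a..b}" for i
    using assms(5) by (auto simp: eig)
  define r where "r = 1 / p"
  have r: "0 \<le> r" "r \<le> 1" using assms(8) by (auto simp: r_def)
  define e where "e i = (poly (psi p a b N) (d i))\<^sup>2" for i
  define T where "T = (\<Sum>i\<in>UNIV. e i)"
  define S where "S = (\<Sum>i\<in>UNIV. d i powr p)"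
  define \<tau> where "\<tau> = schatten_norm p A"
  define X where "X \<omega> = 1 / real M * (\<Sum>j=1..M. \<Sum>i\<in>UNIV. e i * ((transpose Q *v w j \<omega>) $ i)\<^sup>2)" for \<omega>
  have \<tau>: "\<tau> = S powr r"
    by (simp add: \<tau>_def schatten_norm_def eig S_def r_def sum_unfold_sum_mset image_mset.compositionality comp_def)
  have "0 < d i powr p" for i
    using d[of i] assms(2) by auto
  then have S0: "S > 0"
    unfolding S_def by (intro sum_pos) auto
  have "\<bar>e i - d i powr p\<bar> \<le> \<epsilon> / 2 * d i powr p" for i
    unfolding e_def using assms(2,3,6-8,10,11) d[of i]
    by (intro psi_square_relative_error[where \<kappa> = \<kappa>]) (auto simp: assms(9))
  then have "\<bar>\<Sum>i\<in>UNIV. e i - d i powr p\<bar> \<le> (\<Sum>i\<in>UNIV. \<epsilon> / 2 * d i powr p)"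
    by (intro order_trans[OF sum_abs] sum_mono)
  then have TS: "\<bar>T - S\<bar> \<le> \<epsilon> / 2 * S"
    by (simp add: T_def S_def sum_subtractf sum_distrib_left)
  then have TS': "\<bar>T / S - 1\<bar> \<le> \<epsilon> / 2"
    using S0 by (simp add: abs_le_iff field_simps)
  \<comment> \<open>With \<open>\<epsilon> \<le> 1\<close> the bound \<open>TS\<close> yields
    \<open>T \<ge> S / 2\<close>, so division by \<open>T\<close> is legitimate.\<close>
  have "\<epsilon> / 2 * S \<le> 1 / 2 * S"
    using S0 assms(7) by (intro mult_right_mono) auto
  then have T0: "T > 0" using TS S0 by linarith
  have \<tau>0: "\<tau> > 0" using S0 by (simp add: \<tau>)
  have bias: "\<bar>T powr r - \<tau>\<bar> \<le> \<epsilon> / 2 * \<tau>"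
  proof -
    have "\<bar>T powr r - S powr r\<bar> \<le> S powr r * \<bar>T / S - 1\<bar>"
      using T0 S0 r by (intro abs_powr_diff_le) auto
    also have "\<dots> \<le> S powr r * (\<epsilon> / 2)"
      using TS' by (intro mult_left_mono) auto
    finally show ?thesis by (simp add: \<tau> mult.commute)
  qed
  have T\<tau>: "T powr r \<le> (1 + \<epsilon> / 2) * \<tau>"
    using abs_le_D1[OF bias] by (simp add: algebra_simps)
  have Y: "Y_est p a b A w M N \<omega> = X \<omega> powr r" for \<omega>
  proof -
    have "phi_matrix p a b N A = matrix_power (Q ** diag_matrix (\<lambda>i. poly (psi p a b N) (d i)) ** transpose Q) 2"
      by (simp add: phi_matrix_def A matrix_poly_orthogonal_diag_conj[OF Q] matrix_power_def numeral_2_eq_2)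
    also have "\<dots> = Q ** diag_matrix e ** transpose Q"
      by (simp add: matrix_power_orthogonal_diag_conj[OF Q] e_def[abs_def])
    finally show ?thesis
      by (simp add: Y_est_def X_def inner_orthogonal_diag_conj r_def)
  qed
  have X0: "0 \<le> X \<omega>" for \<omega>
    unfolding X_def e_def by (intro mult_nonneg_nonneg sum_nonneg) auto
  have var: "\<bar>X \<omega> powr r - T powr r\<bar> \<le> (1 + \<epsilon> / 2) * \<tau> * \<bar>X \<omega> / T - 1\<bar>" for \<omega>
    using abs_powr_diff_le[OF X0 T0 r] mult_right_mono[OF T\<tau>, of "\<bar>X \<omega> / T - 1\<bar>"]
    by (rule order_trans) simp
  \<comment> \<open>These are the coordinates of the samples in the eigenbasis of \<open>A\<close>,
    the ones that occur in \<open>X\<close>.\<close>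
  have "indep_std_gaussian_vectors P M (\<lambda>j \<omega>. transpose Q *v w j \<omega>)"
    using assms(12) Q by (intro indep_std_gaussian_vectors_orthogonal_matrix) simp_all
  note conc = gaussian_quadratic_mean_concentration[OF this _ _ T0[unfolded T_def], folded T_def X_def]
  have e0: "0 \<le> e i" for i by (simp add: e_def)
  show ?thesis
    unfolding \<tau>_def[symmetric]
  proof (intro conjI impI allI)
    assume M: "1 \<le> M"
    have XT: "integrable P (\<lambda>\<omega>. X \<omega> / T)" and EX: "expectation (\<lambda>\<omega>. \<bar>X \<omega> / T - 1\<bar>) \<le> sqrt (2 / real M)"
      using conc(1,2)[OF M e0] .
    have [measurable]: "X \<in> borel_measurable P"
    proof -
      have "integrable P (\<lambda>\<omega>. T * (X \<omega> / T))" using XT by (rule integrable_mult_right)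
      then show ?thesis using T0 by auto
    qed
    \<comment> \<open>By \<open>var\<close> this function dominates the deviation of the root, which
      gives integrability of the estimator as well as the bound on its mean.\<close>
    have dom: "integrable P (\<lambda>\<omega>. (1 + \<epsilon> / 2) * \<tau> * \<bar>X \<omega> / T - 1\<bar>)"
      using XT by (intro integrable_mult_right integrable_abs integrable_diff) auto
    have diff: "integrable P (\<lambda>\<omega>. X \<omega> powr r - T powr r)"
      by (rule Bochner_Integration.integrable_bound[OF dom]) (auto intro!: AE_I2 order_trans[OF var])
    then have "integrable P (\<lambda>\<omega>. (X \<omega> powr r - T powr r) + T powr r)"
      by (intro Bochner_Integration.integrable_add) auto
    then have intY: "integrable P (\<lambda>\<omega>. X \<omega> powr r)" by simp
    then show "integrable P (Y_est p a b A w M N)"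
      by (simp add: Y cong: Bochner_Integration.integrable_cong)
    have "\<bar>expectation (\<lambda>\<omega>. X \<omega> powr r) - T powr r\<bar> = \<bar>expectation (\<lambda>\<omega>. X \<omega> powr r - T powr r)\<bar>"
      using intY by (simp add: prob_space)
    also have "\<dots> \<le> expectation (\<lambda>\<omega>. \<bar>X \<omega> powr r - T powr r\<bar>)"
      by (rule integral_abs_bound)
    also have "\<dots> \<le> expectation (\<lambda>\<omega>. (1 + \<epsilon> / 2) * \<tau> * \<bar>X \<omega> / T - 1\<bar>)"
      using diff dom var by (intro integral_mono) auto
    also have "\<dots> \<le> (1 + \<epsilon> / 2) * \<tau> * sqrt (2 / real M)"
      using EX \<tau>0 assms(6) by (simp add: mult_left_mono)
    finally have "\<bar>expectation (\<lambda>\<omega>. X \<omega> powr r) - T powr r\<bar> \<le> (1 + \<epsilon> / 2) * \<tau> * sqrt (2 / real M)" .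
    then have "\<bar>expectation (\<lambda>\<omega>. X \<omega> powr r) - \<tau>\<bar> \<le> (1 + \<epsilon> / 2) * \<tau> * sqrt (2 / real M) + \<epsilon> / 2 * \<tau>"
      using bias by linarith
    then show "\<bar>expectation (Y_est p a b A w M N) - \<tau>\<bar>
        \<le> (1 + \<epsilon> / 2) * \<tau> * (2 / real M) powr (1 / 2) + \<epsilon> / 2 * \<tau>"
      by (simp add: Y powr_half_sqrt cong: Bochner_Integration.integral_cong)
  next
    fix \<delta> :: real
    assume "0 < \<delta> \<and> \<delta> < 1 \<and> 72 / \<epsilon>\<^sup>2 * ln (2 / \<delta>) \<le> real M"
    then have \<delta>: "0 < \<delta>" "\<delta> < 1" and M: "72 / \<epsilon>\<^sup>2 * ln (2 / \<delta>) \<le> real M" by auto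
    have "ln (2 / \<delta>) > 0" using \<delta> by simp
    then have "72 / \<epsilon>\<^sup>2 * ln (2 / \<delta>) > 0" using assms(6) by simp
    \<comment> \<open>The lower bound on \<open>M\<close> is positive, which excludes
      \<open>M = 0\<close>.\<close>
    then have M1: "1 \<le> M" using M by (cases M) auto
    \<comment> \<open>With this choice \<open>8 / \<eta>\<^sup>2\<close> equals
      \<open>72 / \<epsilon>\<^sup>2\<close>, and \<open>(1 + \<epsilon> / 2) * \<eta> \<le> 3 / 2 *
      \<eta> = \<epsilon> / 2\<close>. The other \<open>\<epsilon> / 2\<close> is left for the
      bias.\<close>
    define \<eta> where "\<eta> = \<epsilon> / 3"
    have \<eta>: "0 < \<eta>" "\<eta> \<le> 1" using assms(6,7) by (auto simp: \<eta>_def)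
    have "ln (2 / \<delta>) \<le> real M * \<eta>\<^sup>2 / 8"
      using M assms(6) by (simp add: \<eta>_def field_simps)
    then have "exp (- (real M * \<eta>\<^sup>2 / 8)) \<le> exp (- ln (2 / \<delta>))" by simp
    also have "\<dots> = \<delta> / 2" using \<delta> by (simp add: exp_minus)
    finally have "1 - \<delta> \<le> 1 - 2 * exp (- (real M * \<eta>\<^sup>2 / 8))" by simp
    also have "\<dots> \<le> prob {\<omega>\<in>space P. \<bar>X \<omega> / T - 1\<bar> \<le> \<eta>}"
      by (rule conc(3)[OF M1 e0 \<eta>])
    also have "\<dots> \<le> prob {\<omega>\<in>space P. \<bar>X \<omega> powr r - \<tau>\<bar> \<le> \<epsilon> * \<tau>}"
    proof (rule finite_measure_mono)
      have [measurable]: "X \<in> borel_measurable P"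
      proof -
        have "integrable P (\<lambda>\<omega>. T * (X \<omega> / T))"
          using conc(1)[OF M1 e0] by (rule integrable_mult_right)
        then show ?thesis using T0 by auto
      qed
      show "{\<omega>\<in>space P. \<bar>X \<omega> powr r - \<tau>\<bar> \<le> \<epsilon> * \<tau>} \<in> events" by measurable
      have "\<bar>X \<omega> powr r - \<tau>\<bar> \<le> \<epsilon> * \<tau>" if "\<bar>X \<omega> / T - 1\<bar> \<le> \<eta>" for \<omega>
      proof -
        have "(1 + \<epsilon> / 2) * \<tau> * \<bar>X \<omega> / T - 1\<bar> \<le> (3 / 2) * \<tau> * \<eta>"
          using that assms(6,7) \<tau>0 by (intro mult_mono) auto
        then have "\<bar>X \<omega> powr r - T powr r\<bar> \<le> \<epsilon> / 2 * \<tau>"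
          using var[of \<omega>] by (simp add: \<eta>_def)
        then show ?thesis using bias by linarith
      qed
      then show "{\<omega>\<in>space P. \<bar>X \<omega> / T - 1\<bar> \<le> \<eta>} \<subseteq> {\<omega>\<in>space P. \<bar>X \<omega> powr r - \<tau>\<bar> \<le> \<epsilon> * \<tau>}"
        by auto
    qed
    finally show "eps_delta_estimator P \<epsilon> \<delta> (Y_est p a b A w M N) \<tau>"
      by (simp add: eps_delta_estimator_def Y)
  qed
qed

end
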